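(* Let $(M,\varphi,\eta,\xi,g)$ be a quasi-para-Sasakian manifold of dimension greater than $3$. If $(M,g)$ is conformally flat, then $M$ is a space of constant negative curvature $-1$.
   Context: An almost paracontact metric manifold $(M,\varphi,\eta,\xi,g)$ is a smooth manifold $M$ of dimension $2n+1$ ($n\ge 1$) with a $(1,1)$-tensor field $\varphi$, a vector field $\xi$, a 1-form $\eta$ and a pseudo-Riemannian metric $g$ such that $\varphi\xi=0$, $\eta\circ\varphi=0$, $\eta(\xi)=1$, $\varphi^2=\mathrm{id}-\eta\otimes\xi$, $\varphi$ induces an almost paracomplex structure on each fibre of $\mathbb D=\ker\eta$, and $g(\varphi X,\varphi Y)=-g(X,Y)+\eta(X)\eta(Y)$ for all $X,Y$ (hence $\eta(X)=g(X,\xi)$ and $g$ has signature $(n+1,n)$). It is quasi-para-Sasakian if $(\nabla_X\varphi)Y=g(X,Y)\xi-\eta(Y)X$ for all vector fields $X,Y$, where $\nabla$ is the Levi-Civita connection of $g$. The curvature tensor is $R(X,Y)Z=\nabla_X\nabla_YZ-\nabla_Y\nabla_XZ-\nabla_{[X,Y]}Z$; constant curvature $c$ means $R(X,Y)Z=c\,(g(Y,Z)X-g(X,Z)Y)$ for all $X,Y,Z$. *)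

theory Defs
  imports "HOL-Analysis.Analysis"
begin

section \<open>Smooth maps between Euclidean spaces\<close>

text \<open>Both notions are meant for open \<open>S\<close>.\<close>

primrec Ck_on :: "nat \<Rightarrow> ('a::euclidean_space \<Rightarrow> 'b::real_normed_vector) \<Rightarrow> 'a set \<Rightarrow> bool" where
  "Ck_on 0 f S \<longleftrightarrow> continuous_on S f"
| "Ck_on (Suc k) f S \<longleftrightarrow> (\<forall>x\<in>S. f differentiable (at x)) \<and>
     (\<forall>v. Ck_on k (\<lambda>x. frechet_derivative f (at x) v) S)"

definition smooth_on :: "('a::euclidean_space \<Rightarrow> 'b::real_normed_vector) \<Rightarrow> 'a set \<Rightarrow> bool" where
  "smooth_on f S \<longleftrightarrow> (\<forall>k. Ck_on k f S)"


section \<open>Smooth manifolds\<close>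

text \<open>A chart is a pair of a domain and a coordinate map, whose values outside the domain are
  irrelevant. An atlas need not be maximal: none of the notions below changes when compatible
  charts are added. The dimension of the manifold is \<open>DIM('e)\<close>.\<close>

type_synonym ('m, 'e) chart = "'m set \<times> ('m \<Rightarrow> 'e)"

definition chart_image :: "('m, 'e) chart \<Rightarrow> 'm set \<Rightarrow> 'e set" where
  "chart_image c U = snd c ` (fst c \<inter> U)"

definition chart_inv :: "('m, 'e) chart \<Rightarrow> 'e \<Rightarrow> 'm" where
  "chart_inv c = inv_into (fst c) (snd c)"

definition transition :: "('m, 'e) chart \<Rightarrow> ('m, 'e) chart \<Rightarrow> 'e \<Rightarrow> 'e" where
  "transition c d = snd d \<circ> chart_inv c"

definition smooth_atlas :: "'m topology \<Rightarrow> ('m, 'e::euclidean_space) chart set \<Rightarrow> bool" where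
  "smooth_atlas T A \<longleftrightarrow>
     (\<forall>c\<in>A. openin T (fst c) \<and> open (snd c ` fst c) \<and>
        homeomorphic_map (subtopology T (fst c)) (top_of_set (snd c ` fst c)) (snd c)) \<and>
     (\<Union>c\<in>A. fst c) = topspace T \<and>
     (\<forall>c\<in>A. \<forall>d\<in>A. smooth_on (transition c d) (chart_image c (fst d)))"

definition smooth_manifold :: "'m topology \<Rightarrow> ('m, 'e::euclidean_space) chart set \<Rightarrow> bool" where
  "smooth_manifold T A \<longleftrightarrow> Hausdorff_space T \<and> second_countable T \<and> smooth_atlas T A"


section \<open>Tangent vectors\<close>

text \<open>A tangent vector is the family of its component vectors in all charts; the components in two
  charts are related by the derivative of the transition map. This is the construction of the
  tangent space by equivalence classes of pairs of a chart and a vector. The datatype only serves to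
  make these families a real vector space, of which each tangent space is a linear subspace.\<close>

datatype ('m, 'e) tvec = TVec (comp: "('m, 'e) chart \<Rightarrow> 'e")

instantiation tvec :: (type, real_vector) real_vector
begin

definition "0 = TVec (\<lambda>c. 0)"
definition "v + w = TVec (\<lambda>c. comp v c + comp w c)"
definition "- v = TVec (\<lambda>c. - comp v c)"
definition "v - w = TVec (\<lambda>c. comp v c - comp w c)"
definition "a *\<^sub>R v = TVec (\<lambda>c. a *\<^sub>R comp v c)"

instance
  by standard
    (simp_all add: zero_tvec_def plus_tvec_def uminus_tvec_def minus_tvec_def scaleR_tvec_def
      algebra_simps)

end

text \<open>The first condition normalizes the components in charts that are not around \<open>p\<close>.\<close>

definition tangent_space ::
    "('m, 'e::euclidean_space) chart set \<Rightarrow> 'm \<Rightarrow> ('m, 'e) tvec set" where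
  "tangent_space A p = {v.
     (\<forall>c. \<not> (c \<in> A \<and> p \<in> fst c) \<longrightarrow> comp v c = 0) \<and>
     (\<forall>c\<in>A. \<forall>d\<in>A. p \<in> fst c \<and> p \<in> fst d \<longrightarrow>
        comp v d = frechet_derivative (transition c d) (at (snd c p)) (comp v c))}"


section \<open>Functions, vector fields and tensor fields on an open set\<close>

text \<open>Throughout, \<open>U\<close> is an open subset of the manifold, viewed as a manifold itself; values of
  fields outside \<open>U\<close> are irrelevant.\<close>

definition smooth_function ::
    "('m, 'e::euclidean_space) chart set \<Rightarrow> 'm set \<Rightarrow> ('m \<Rightarrow> real) \<Rightarrow> bool" where
  "smooth_function A U f \<longleftrightarrow> (\<forall>c\<in>A. smooth_on (f \<circ> chart_inv c) (chart_image c U))"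

definition vector_fields ::
    "('m, 'e::euclidean_space) chart set \<Rightarrow> 'm set \<Rightarrow> ('m \<Rightarrow> ('m, 'e) tvec) set" where
  "vector_fields A U = {X. (\<forall>p\<in>U. X p \<in> tangent_space A p) \<and>
     (\<forall>c\<in>A. smooth_on (\<lambda>x. comp (X (chart_inv c x)) c) (chart_image c U))}"

definition chart_at :: "('m, 'e) chart set \<Rightarrow> 'm \<Rightarrow> ('m, 'e) chart" where
  "chart_at A p = (SOME c. c \<in> A \<and> p \<in> fst c)"

text \<open>The derivative \<open>X f\<close>; by the chain rule it does not depend on the chart chosen.\<close>

definition field_deriv :: "('m, 'e::euclidean_space) chart set \<Rightarrow>
    ('m \<Rightarrow> ('m, 'e) tvec) \<Rightarrow> ('m \<Rightarrow> real) \<Rightarrow> 'm \<Rightarrow> real" where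
  "field_deriv A X f p = (let c = chart_at A p in
     frechet_derivative (f \<circ> chart_inv c) (at (snd c p)) (comp (X p) c))"

text \<open>In a chart, \<open>[X,Y]\<^sup>i = X\<^sup>j \<partial>\<^sub>j Y\<^sup>i - Y\<^sup>j \<partial>\<^sub>j X\<^sup>i\<close>.\<close>

definition lie_bracket :: "('m, 'e::euclidean_space) chart set \<Rightarrow>
    ('m \<Rightarrow> ('m, 'e) tvec) \<Rightarrow> ('m \<Rightarrow> ('m, 'e) tvec) \<Rightarrow> 'm \<Rightarrow> ('m, 'e) tvec" where
  "lie_bracket A X Y p = TVec (\<lambda>c. if c \<in> A \<and> p \<in> fst c then
       frechet_derivative (\<lambda>x. comp (Y (chart_inv c x)) c) (at (snd c p)) (comp (X p) c)
     - frechet_derivative (\<lambda>x. comp (X (chart_inv c x)) c) (at (snd c p)) (comp (Y p) c)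
     else 0)"

definition one_form :: "('m, 'e::euclidean_space) chart set \<Rightarrow> 'm set \<Rightarrow>
    ('m \<Rightarrow> ('m, 'e) tvec \<Rightarrow> real) \<Rightarrow> bool" where
  "one_form A U \<eta> \<longleftrightarrow>
     (\<forall>p\<in>U. \<forall>v\<in>tangent_space A p. \<forall>w\<in>tangent_space A p. \<forall>a b.
        \<eta> p (a *\<^sub>R v + b *\<^sub>R w) = a * \<eta> p v + b * \<eta> p w) \<and>
     (\<forall>X\<in>vector_fields A U. smooth_function A U (\<lambda>p. \<eta> p (X p)))"

definition endomorphism_field :: "('m, 'e::euclidean_space) chart set \<Rightarrow> 'm set \<Rightarrow>
    ('m \<Rightarrow> ('m, 'e) tvec \<Rightarrow> ('m, 'e) tvec) \<Rightarrow> bool" where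
  "endomorphism_field A U \<phi> \<longleftrightarrow>
     (\<forall>p\<in>U. \<forall>v\<in>tangent_space A p. \<phi> p v \<in> tangent_space A p) \<and>
     (\<forall>p\<in>U. \<forall>v\<in>tangent_space A p. \<forall>w\<in>tangent_space A p. \<forall>a b.
        \<phi> p (a *\<^sub>R v + b *\<^sub>R w) = a *\<^sub>R \<phi> p v + b *\<^sub>R \<phi> p w) \<and>
     (\<forall>X\<in>vector_fields A U. (\<lambda>p. \<phi> p (X p)) \<in> vector_fields A U)"

definition pseudo_riemannian_metric :: "('m, 'e::euclidean_space) chart set \<Rightarrow> 'm set \<Rightarrow>
    ('m \<Rightarrow> ('m, 'e) tvec \<Rightarrow> ('m, 'e) tvec \<Rightarrow> real) \<Rightarrow> bool" where
  "pseudo_riemannian_metric A U g \<longleftrightarrow>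
     (\<forall>p\<in>U. \<forall>u\<in>tangent_space A p. \<forall>v\<in>tangent_space A p. \<forall>w\<in>tangent_space A p. \<forall>a b.
        g p (a *\<^sub>R u + b *\<^sub>R v) w = a * g p u w + b * g p v w) \<and>
     (\<forall>p\<in>U. \<forall>v\<in>tangent_space A p. \<forall>w\<in>tangent_space A p. g p v w = g p w v) \<and>
     (\<forall>p\<in>U. \<forall>v\<in>tangent_space A p. (\<forall>w\<in>tangent_space A p. g p v w = 0) \<longrightarrow> v = 0) \<and>
     (\<forall>X\<in>vector_fields A U. \<forall>Y\<in>vector_fields A U. smooth_function A U (\<lambda>p. g p (X p) (Y p)))"


section \<open>Levi-Civita connection and curvature\<close>

text \<open>\<open>D X Y\<close> is the covariant derivative of \<open>Y\<close> along \<open>X\<close>.\<close>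

type_synonym ('m, 'e) connection =
  "('m \<Rightarrow> ('m, 'e) tvec) \<Rightarrow> ('m \<Rightarrow> ('m, 'e) tvec) \<Rightarrow> 'm \<Rightarrow> ('m, 'e) tvec"

definition affine_connection ::
    "('m, 'e::euclidean_space) chart set \<Rightarrow> 'm set \<Rightarrow> ('m, 'e) connection \<Rightarrow> bool" where
  "affine_connection A U D \<longleftrightarrow>
     (\<forall>X\<in>vector_fields A U. \<forall>Y\<in>vector_fields A U. D X Y \<in> vector_fields A U) \<and>
     (\<forall>X\<in>vector_fields A U. \<forall>Y\<in>vector_fields A U. \<forall>Z\<in>vector_fields A U. \<forall>p\<in>U.
        D (\<lambda>q. X q + Y q) Z p = D X Z p + D Y Z p \<and>
        D X (\<lambda>q. Y q + Z q) p = D X Y p + D X Z p) \<and>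
     (\<forall>f. smooth_function A U f \<longrightarrow> (\<forall>X\<in>vector_fields A U. \<forall>Y\<in>vector_fields A U. \<forall>p\<in>U.
        D (\<lambda>q. f q *\<^sub>R X q) Y p = f p *\<^sub>R D X Y p \<and>
        D X (\<lambda>q. f q *\<^sub>R Y q) p = field_deriv A X f p *\<^sub>R Y p + f p *\<^sub>R D X Y p))"

definition levi_civita_connection :: "('m, 'e::euclidean_space) chart set \<Rightarrow> 'm set \<Rightarrow>
    ('m \<Rightarrow> ('m, 'e) tvec \<Rightarrow> ('m, 'e) tvec \<Rightarrow> real) \<Rightarrow> ('m, 'e) connection \<Rightarrow> bool" where
  "levi_civita_connection A U g D \<longleftrightarrow> affine_connection A U D \<and>
     (\<forall>X\<in>vector_fields A U. \<forall>Y\<in>vector_fields A U. \<forall>p\<in>U.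
        D X Y p - D Y X p = lie_bracket A X Y p) \<and>
     (\<forall>X\<in>vector_fields A U. \<forall>Y\<in>vector_fields A U. \<forall>Z\<in>vector_fields A U. \<forall>p\<in>U.
        field_deriv A X (\<lambda>q. g q (Y q) (Z q)) p = g p (D X Y p) (Z p) + g p (Y p) (D X Z p))"

definition curvature :: "('m, 'e::euclidean_space) chart set \<Rightarrow> ('m, 'e) connection \<Rightarrow>
    ('m \<Rightarrow> ('m, 'e) tvec) \<Rightarrow> ('m \<Rightarrow> ('m, 'e) tvec) \<Rightarrow> ('m \<Rightarrow> ('m, 'e) tvec) \<Rightarrow> 'm \<Rightarrow> ('m, 'e) tvec"
  where "curvature A D X Y Z p = D X (D Y Z) p - D Y (D X Z) p - D (lie_bracket A X Y) Z p"

text \<open>In the next definition \<open>D\<close> stands for the Levi-Civita connection of \<open>g\<close>.\<close>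

definition constant_curvature :: "('m, 'e::euclidean_space) chart set \<Rightarrow> 'm set \<Rightarrow>
    ('m \<Rightarrow> ('m, 'e) tvec \<Rightarrow> ('m, 'e) tvec \<Rightarrow> real) \<Rightarrow> ('m, 'e) connection \<Rightarrow> real \<Rightarrow> bool" where
  "constant_curvature A U g D c \<longleftrightarrow>
     (\<forall>X\<in>vector_fields A U. \<forall>Y\<in>vector_fields A U. \<forall>Z\<in>vector_fields A U. \<forall>p\<in>U.
        curvature A D X Y Z p =
          c *\<^sub>R (g p (Y p) (Z p) *\<^sub>R X p - g p (X p) (Z p) *\<^sub>R Y p))"

text \<open>A metric is flat if the curvature of its Levi-Civita connection vanishes. The metric \<open>g\<close> is
  conformally flat if every point has an open neighbourhood \<open>U\<close> on which some \<open>e\<^sup>2\<^sup>f g\<close> is flat.\<close>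

definition flat_metric :: "('m, 'e::euclidean_space) chart set \<Rightarrow> 'm set \<Rightarrow>
    ('m \<Rightarrow> ('m, 'e) tvec \<Rightarrow> ('m, 'e) tvec \<Rightarrow> real) \<Rightarrow> bool" where
  "flat_metric A U g \<longleftrightarrow> (\<exists>D. levi_civita_connection A U g D \<and>
     (\<forall>X\<in>vector_fields A U. \<forall>Y\<in>vector_fields A U. \<forall>Z\<in>vector_fields A U. \<forall>p\<in>U.
        curvature A D X Y Z p = 0))"

definition conformally_flat :: "'m topology \<Rightarrow> ('m, 'e::euclidean_space) chart set \<Rightarrow>
    ('m \<Rightarrow> ('m, 'e) tvec \<Rightarrow> ('m, 'e) tvec \<Rightarrow> real) \<Rightarrow> bool" where
  "conformally_flat T A g \<longleftrightarrow> (\<forall>p\<in>topspace T. \<exists>U f. openin T U \<and> p \<in> U \<and>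
     smooth_function A U f \<and> flat_metric A U (\<lambda>q v w. exp (2 * f q) * g q v w))"


section \<open>Quasi-para-Sasakian manifolds\<close>

text \<open>An almost paracomplex structure on a vector space \<open>V\<close>: an endomorphism with square the identity
  whose eigenspaces for \<open>1\<close> and \<open>-1\<close> have the same dimension.\<close>

definition almost_paracomplex_on :: "'v::real_vector set \<Rightarrow> ('v \<Rightarrow> 'v) \<Rightarrow> bool" where
  "almost_paracomplex_on V J \<longleftrightarrow>
     (\<forall>v\<in>V. J v \<in> V) \<and>
     (\<forall>v\<in>V. \<forall>w\<in>V. \<forall>a b. J (a *\<^sub>R v + b *\<^sub>R w) = a *\<^sub>R J v + b *\<^sub>R J w) \<and>
     (\<forall>v\<in>V. J (J v) = v) \<and>
     dim {v\<in>V. J v = v} = dim {v\<in>V. J v = - v}"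

definition almost_paracontact_metric :: "'m topology \<Rightarrow> ('m, 'e::euclidean_space) chart set \<Rightarrow>
    ('m \<Rightarrow> ('m, 'e) tvec \<Rightarrow> ('m, 'e) tvec) \<Rightarrow> ('m \<Rightarrow> ('m, 'e) tvec \<Rightarrow> real) \<Rightarrow>
    ('m \<Rightarrow> ('m, 'e) tvec) \<Rightarrow> ('m \<Rightarrow> ('m, 'e) tvec \<Rightarrow> ('m, 'e) tvec \<Rightarrow> real) \<Rightarrow> bool" where
  "almost_paracontact_metric T A \<phi> \<eta> \<xi> g \<longleftrightarrow>
     smooth_manifold T A \<and> (\<exists>n\<ge>1. DIM('e) = 2 * n + 1) \<and>
     endomorphism_field A (topspace T) \<phi> \<and>
     one_form A (topspace T) \<eta> \<and>
     \<xi> \<in> vector_fields A (topspace T) \<and>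
     pseudo_riemannian_metric A (topspace T) g \<and>
     (\<forall>p\<in>topspace T.
        \<phi> p (\<xi> p) = 0 \<and>
        \<eta> p (\<xi> p) = 1 \<and>
        (\<forall>v\<in>tangent_space A p. \<eta> p (\<phi> p v) = 0 \<and> \<phi> p (\<phi> p v) = v - \<eta> p v *\<^sub>R \<xi> p) \<and>
        almost_paracomplex_on {v\<in>tangent_space A p. \<eta> p v = 0} (\<phi> p) \<and>
        (\<forall>v\<in>tangent_space A p. \<forall>w\<in>tangent_space A p.
           g p (\<phi> p v) (\<phi> p w) = - g p v w + \<eta> p v * \<eta> p w))"

text \<open>The left-hand side of the last equation is \<open>(D\<^sub>X \<phi>) Y\<close>.\<close>

definition quasi_para_Sasakian :: "'m topology \<Rightarrow> ('m, 'e::euclidean_space) chart set \<Rightarrow>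
    ('m \<Rightarrow> ('m, 'e) tvec \<Rightarrow> ('m, 'e) tvec) \<Rightarrow> ('m \<Rightarrow> ('m, 'e) tvec \<Rightarrow> real) \<Rightarrow>
    ('m \<Rightarrow> ('m, 'e) tvec) \<Rightarrow> ('m \<Rightarrow> ('m, 'e) tvec \<Rightarrow> ('m, 'e) tvec \<Rightarrow> real) \<Rightarrow>
    ('m, 'e) connection \<Rightarrow> bool" where
  "quasi_para_Sasakian T A \<phi> \<eta> \<xi> g D \<longleftrightarrow>
     almost_paracontact_metric T A \<phi> \<eta> \<xi> g \<and>
     levi_civita_connection A (topspace T) g D \<and>
     (\<forall>X\<in>vector_fields A (topspace T). \<forall>Y\<in>vector_fields A (topspace T). \<forall>p\<in>topspace T.
        D X (\<lambda>q. \<phi> q (Y q)) p - \<phi> p (D X Y p) =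
          g p (X p) (Y p) *\<^sub>R \<xi> p - \<eta> p (Y p) *\<^sub>R X p)"

end

theory Submission
  imports Defs
begin

text \<open>
  From the structure equation, \<open>D\<^sub>X \<xi> = \<phi>X\<close>; differentiating it and the equation for \<open>D\<phi>\<close> again gives
  \<open>R(X,Y)\<xi> = \<eta>(X)Y - \<eta>(Y)X\<close> and a formula for \<open>R(X,Y)\<phi>Z - \<phi>R(X,Y)Z\<close>.
  If \<open>e\<^sup>2\<^sup>f g\<close> has a flat connection \<open>D'\<close>, then \<open>R(X,Y)Z = -s(X,Y)Z + B(Y,Z)X - B(X,Z)Y + g(Y,Z)QX - g(X,Z)QY\<close>, with
  \<open>B(Y,Z) = Y(Zf) - (D\<^sub>Y Z)f - (Yf)(Zf)\<close>, \<open>QX = D'\<^sub>X(grad f) - (Xf) grad f\<close> and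
  \<open>s(X,Y) = X(Yf) - Y(Xf) - [X,Y]f\<close>. In fact \<open>s = 0\<close> and \<open>B\<close> is symmetric and tensorial, but none of
  this is used: as the eigenspaces of \<open>\<phi>\<close> for \<open>1\<close> and \<open>-1\<close> have dimension at least \<open>2\<close>, inserting
  eigenvectors in general position into the three identities determines \<open>s\<close>, \<open>B\<close> and \<open>Q\<close> up to
  \<open>\<lambda> = B(\<xi>,\<xi>)\<close>: \<open>s = 0\<close>, \<open>B = \<lambda>g\<close>, \<open>QX = -(1 + \<lambda>)X\<close>, and \<open>\<lambda>\<close> cancels in \<open>R\<close>.
\<close>

section \<open>Smooth functions and bump functions\<close>

lemma Ck_on_subset: "Ck_on k f S \<Longrightarrow> R \<subseteq> S \<Longrightarrow> Ck_on k f R"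
  by (induction k arbitrary: f) (auto intro: continuous_on_subset)

lemma Ck_on_SucD: "Ck_on (Suc k) f S \<Longrightarrow> Ck_on k f S"
proof (induction k arbitrary: f)
  case 0
  then show ?case
    by (auto intro!: continuous_at_imp_continuous_on differentiable_imp_continuous_within)
next
  case (Suc k)
  then show ?case by (metis Ck_on.simps(2))
qed

text \<open>\<open>frechet_derivative\<close> is taken with respect to \<open>at x\<close>, so every
  step of the recursion sees only an open set around \<open>x\<close>. This allows smoothness to be
  checked piece by piece on an open cover.\<close>

lemma Ck_on_local:
  assumes "\<And>x. x \<in> S \<Longrightarrow> \<exists>R. open R \<and> x \<in> R \<and> Ck_on k f R"
  shows "Ck_on k f S"
  using assms
proof (induction k arbitrary: f)
  case 0
  then show ?case
    by (metis Ck_on.simps(1) continuous_at_imp_continuous_on continuous_on_eq_continuous_at)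
next
  case (Suc k)
  have "f differentiable at x" if "x \<in> S" for x
    using Suc.prems[OF that] by auto
  moreover have "Ck_on k (\<lambda>x. frechet_derivative f (at x) v) S" for v
  proof (rule Suc.IH)
    fix x assume "x \<in> S"
    from Suc.prems[OF this] show "\<exists>R. open R \<and> x \<in> R \<and> Ck_on k (\<lambda>x. frechet_derivative f (at x) v) R"
      by auto
  qed
  ultimately show ?case by simp
qed

lemma Ck_on_cong:
  assumes "open S" "\<And>x. x \<in> S \<Longrightarrow> f x = g x" "Ck_on k f S"
  shows "Ck_on k g S"
  using assms(2,3)
proof (induction k arbitrary: f g)
  case 0
  then show ?case using continuous_on_cong[of S S f g] by auto
next
  case (Suc k)
  have D: "(g has_derivative frechet_derivative f (at x)) (at x)" if "x \<in> S" for x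
    using Suc.prems that assms(1) frechet_derivative_works[of f "at x"]
    by (intro has_derivative_transform_within_open[of f _ x UNIV S g]) auto
  have "Ck_on k (\<lambda>x. frechet_derivative g (at x) v) S" for v
  proof (rule Suc.IH)
    show "frechet_derivative f (at x) v = frechet_derivative g (at x) v" if "x \<in> S" for x
      by (simp only: frechet_derivative_at[OF D[OF that]])
  qed (use Suc.prems in simp)
  then show ?case using D by (auto simp: differentiable_def)
qed

lemma Ck_on_const: "Ck_on k (\<lambda>x. c) S"
  by (induction k arbitrary: c) auto

lemma Ck_on_add:
  assumes "open S" "Ck_on k f S" "Ck_on k g S"
  shows "Ck_on k (\<lambda>x. f x + g x) S"
  using assms(2,3)
proof (induction k arbitrary: f g)
  case 0
  then show ?case by (auto intro: continuous_intros)
next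
  case (Suc k)
  have D: "((\<lambda>x. f x + g x) has_derivative
      (\<lambda>v. frechet_derivative f (at x) v + frechet_derivative g (at x) v)) (at x)"
    if "x \<in> S" for x
    using Suc.prems that
    by (intro has_derivative_add) (auto simp: frechet_derivative_works[symmetric])
  have "Ck_on k (\<lambda>x. frechet_derivative (\<lambda>x. f x + g x) (at x) v) S" for v
  proof (rule Ck_on_cong[OF assms(1)])
    show "Ck_on k (\<lambda>x. frechet_derivative f (at x) v + frechet_derivative g (at x) v) S"
      using Suc by auto
    show "frechet_derivative f (at x) v + frechet_derivative g (at x) v
        = frechet_derivative (\<lambda>x. f x + g x) (at x) v" if "x \<in> S" for x
      by (simp only: frechet_derivative_at[OF D[OF that], symmetric])
  qed
  then show ?case using D by (auto simp: differentiable_def)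
qed

lemma Ck_on_sum:
  assumes "open S" "finite I" "\<And>i. i \<in> I \<Longrightarrow> Ck_on k (f i) S"
  shows "Ck_on k (\<lambda>x. \<Sum>i\<in>I. f i x) S"
  using assms(2,3) by (induction I) (auto intro: Ck_on_const Ck_on_add[OF assms(1)])

text \<open>The product rule gives two terms of the same bilinear shape, to which the induction
  hypothesis applies once the undifferentiated factor is lowered by one order.\<close>

lemma (in bounded_bilinear) Ck_on:
  assumes "open S" "Ck_on k f S" "Ck_on k g S"
  shows "Ck_on k (\<lambda>x. prod (f x) (g x)) S"
  using assms(2,3)
proof (induction k arbitrary: f g)
  case 0
  then show ?case by (auto intro: continuous_on)
next
  case (Suc k)
  have D: "((\<lambda>x. prod (f x) (g x)) has_derivative
      (\<lambda>v. prod (f x) (frechet_derivative g (at x) v) + prod (frechet_derivative f (at x) v) (g x))) (at x)"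
    if "x \<in> S" for x
    using Suc.prems that by (intro FDERIV) (auto simp: frechet_derivative_works[symmetric])
  have "Ck_on k (\<lambda>x. frechet_derivative (\<lambda>x. prod (f x) (g x)) (at x) v) S" for v
  proof (rule Ck_on_cong[OF assms(1)])
    show "Ck_on k (\<lambda>x. prod (f x) (frechet_derivative g (at x) v) + prod (frechet_derivative f (at x) v) (g x)) S"
      using Suc.prems by (intro Ck_on_add[OF assms(1)] Suc.IH) (auto intro: Ck_on_SucD)
    show "prod (f x) (frechet_derivative g (at x) v) + prod (frechet_derivative f (at x) v) (g x)
        = frechet_derivative (\<lambda>x. prod (f x) (g x)) (at x) v" if "x \<in> S" for x
      by (simp only: frechet_derivative_at[OF D[OF that], symmetric])
  qed
  then show ?case using D by (auto simp: differentiable_def)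
qed

lemmas Ck_on_scaleR = bounded_bilinear.Ck_on[OF bounded_bilinear_scaleR]
lemmas Ck_on_mult = bounded_bilinear.Ck_on[OF bounded_bilinear_mult]
lemmas Ck_on_inner = bounded_bilinear.Ck_on[OF bounded_bilinear_inner]

lemma Ck_on_ident: "Ck_on k (\<lambda>x. x) S"
proof (cases k)
  case (Suc j)
  then show ?thesis by (simp add: frechet_derivative_ident Ck_on_const)
qed simp

text \<open>\<open>Ck_on\<close> controls derivatives only in fixed directions. Directions that vary
  with the point, as in the chain rule or in \<open>X f\<close>, are reduced to the finitely many
  basis directions by this expansion.\<close>

lemma linear_sum_Basis:
  fixes L :: "'a::euclidean_space \<Rightarrow> 'b::real_vector"
  assumes "linear L"
  shows "L v = (\<Sum>i\<in>Basis. (v \<bullet> i) *\<^sub>R L i)"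
proof -
  have "L v = L (\<Sum>i\<in>Basis. (v \<bullet> i) *\<^sub>R i)" by (simp add: euclidean_representation)
  then show ?thesis using assms by (simp add: linear_sum linear_scale)
qed

lemma Ck_on_compose:
  fixes g :: "'a::euclidean_space \<Rightarrow> 'b::euclidean_space"
  assumes "open S" "open R" "g ` S \<subseteq> R" "Ck_on k g S" "Ck_on k f R"
  shows "Ck_on k (\<lambda>x. f (g x)) S"
  using assms(4,5)
proof (induction k arbitrary: f)
  case 0
  then show ?case using assms(3) continuous_on_compose2 by auto
next
  case (Suc k)
  have D: "((\<lambda>x. f (g x)) has_derivative
      (\<lambda>v. frechet_derivative f (at (g x)) (frechet_derivative g (at x) v))) (at x)"
    if "x \<in> S" for x
    using Suc.prems that assms(3)
    by (intro has_derivative_compose[of g _ x UNIV f])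
       (auto simp: frechet_derivative_works[symmetric])
  have "Ck_on k (\<lambda>x. frechet_derivative (\<lambda>x. f (g x)) (at x) v) S" for v
  proof (rule Ck_on_cong[OF assms(1)])
    show "Ck_on k (\<lambda>x. \<Sum>i\<in>Basis. (frechet_derivative g (at x) v \<bullet> i)
        *\<^sub>R frechet_derivative f (at (g x)) i) S"
    proof (intro Ck_on_sum Ck_on_scaleR Ck_on_inner Ck_on_const assms(1))
      fix i :: 'b
      show "Ck_on k (\<lambda>x. frechet_derivative f (at (g x)) i) S"
        using Suc.prems by (intro Suc.IH Ck_on_SucD[of k g]) auto
    qed (use Suc.prems in auto)
    show "(\<Sum>i\<in>Basis. (frechet_derivative g (at x) v \<bullet> i) *\<^sub>R frechet_derivative f (at (g x)) i)
       = frechet_derivative (\<lambda>x. f (g x)) (at x) v" if "x \<in> S" for x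
    proof -
      have "linear (frechet_derivative f (at (g x)))"
        using Suc.prems that assms(3) by (intro linear_frechet_derivative) auto
      from linear_sum_Basis[OF this, symmetric] show ?thesis
        unfolding frechet_derivative_at[OF D[OF that], symmetric] by simp
    qed
  qed
  then show ?case using D by (auto simp: differentiable_def)
qed

lemma smooth_onI: "(\<And>k. Ck_on k f S) \<Longrightarrow> smooth_on f S"
  by (simp add: smooth_on_def)

lemma smooth_onD: "smooth_on f S \<Longrightarrow> Ck_on k f S"
  by (simp add: smooth_on_def)

lemma smooth_on_differentiable: "smooth_on f S \<Longrightarrow> x \<in> S \<Longrightarrow> f differentiable at x"
  using smooth_onD[of f S 1] by simp

lemma smooth_on_deriv: "smooth_on f S \<Longrightarrow> smooth_on (\<lambda>x. frechet_derivative f (at x) v) S"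
  by (metis Ck_on.simps(2) smooth_on_def)

lemma smooth_on_subset: "smooth_on f S \<Longrightarrow> R \<subseteq> S \<Longrightarrow> smooth_on f R"
  by (metis Ck_on_subset smooth_on_def)

lemma smooth_on_cong:
  "open S \<Longrightarrow> (\<And>x. x \<in> S \<Longrightarrow> f x = g x) \<Longrightarrow> smooth_on f S \<Longrightarrow> smooth_on g S"
  unfolding smooth_on_def using Ck_on_cong by metis

lemma smooth_on_local:
  "(\<And>x. x \<in> S \<Longrightarrow> \<exists>R. open R \<and> x \<in> R \<and> smooth_on f R) \<Longrightarrow> smooth_on f S"
  unfolding smooth_on_def by (metis Ck_on_local)

lemma smooth_on_const: "smooth_on (\<lambda>x. c) S"
  by (intro smooth_onI Ck_on_const)

lemma smooth_on_ident: "smooth_on (\<lambda>x. x) S"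
  by (intro smooth_onI Ck_on_ident)

lemma smooth_on_add: "open S \<Longrightarrow> smooth_on f S \<Longrightarrow> smooth_on g S \<Longrightarrow> smooth_on (\<lambda>x. f x + g x) S"
  by (simp add: smooth_on_def Ck_on_add)

lemma smooth_on_sum:
  "open S \<Longrightarrow> finite I \<Longrightarrow> (\<And>i. i \<in> I \<Longrightarrow> smooth_on (f i) S) \<Longrightarrow> smooth_on (\<lambda>x. \<Sum>i\<in>I. f i x) S"
  by (simp add: smooth_on_def Ck_on_sum)

lemma smooth_on_scaleR:
  "open S \<Longrightarrow> smooth_on f S \<Longrightarrow> smooth_on g S \<Longrightarrow> smooth_on (\<lambda>x. f x *\<^sub>R g x) S"
  by (simp add: smooth_on_def Ck_on_scaleR)

lemma smooth_on_inner:
  "open S \<Longrightarrow> smooth_on f S \<Longrightarrow> smooth_on g S \<Longrightarrow> smooth_on (\<lambda>x. f x \<bullet> g x) S"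
  by (simp add: smooth_on_def Ck_on_inner)

lemma smooth_on_compose:
  fixes g :: "'a::euclidean_space \<Rightarrow> 'b::euclidean_space"
  assumes "open S" "open R" "g ` S \<subseteq> R" "smooth_on g S" "smooth_on f R"
  shows "smooth_on (\<lambda>x. f (g x)) S"
  using assms Ck_on_compose unfolding smooth_on_def by blast

section \<open>Bump functions from t^(-n) exp(-1/t), a family whose span is closed under
  differentiation\<close>

definition flat_exp :: "nat \<Rightarrow> real \<Rightarrow> real" where
  "flat_exp n t = (if t > 0 then inverse t ^ n / exp (inverse t) else 0)"

lemma flat_exp_tendsto_0: "(flat_exp n \<longlongrightarrow> 0) (at 0)"
proof -
  have "((\<lambda>t. inverse t ^ n / exp (inverse t)) \<longlongrightarrow> 0) (at_right (0::real))"
    by (rule filterlim_compose[OF tendsto_power_div_exp_0 filterlim_inverse_at_top_right])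
  then have "(flat_exp n \<longlongrightarrow> 0) (at_right 0)"
    by (rule Lim_transform_eventually)
       (auto simp: flat_exp_def eventually_at_filter)
  moreover have "(flat_exp n \<longlongrightarrow> 0) (at_left 0)"
    by (rule Lim_transform_eventually[of "\<lambda>_. 0"])
       (auto simp: flat_exp_def eventually_at_filter)
  ultimately show ?thesis by (simp add: filterlim_split_at)
qed

lemma flat_exp_deriv:
  "(flat_exp n has_real_derivative flat_exp (n + 2) t - real n * flat_exp (n + 1) t) (at t)"
proof (cases t "0::real" rule: linorder_cases)
  case less
  have "(flat_exp n has_real_derivative 0) (at t)"
    by (rule has_field_derivative_transform_within_open[of "\<lambda>_. 0" _ _ "{..<0}"])
       (use less in \<open>auto simp: flat_exp_def\<close>)
  then show ?thesis using less by (simp add: flat_exp_def)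
next
  case equal
  \<comment> \<open>The difference quotient at 0 is \<open>flat_exp (n + 1)\<close>, again a member
    of the family, and tends to 0.\<close>
  have "((\<lambda>h. (flat_exp n (0 + h) - flat_exp n 0) / h) \<longlongrightarrow> 0) (at 0)"
  proof (rule Lim_transform_eventually[OF flat_exp_tendsto_0[of "n + 1"]])
    show "\<forall>\<^sub>F h in at 0. flat_exp (n + 1) h = (flat_exp n (0 + h) - flat_exp n 0) / h"
      by (auto simp: flat_exp_def eventually_at_filter field_simps)
  qed
  then show ?thesis using equal by (simp add: DERIV_def flat_exp_def)
next
  case greater
  have "((\<lambda>t. inverse t ^ n / exp (inverse t)) has_real_derivative
      flat_exp (n + 2) t - real n * flat_exp (n + 1) t) (at t)"
  proof (rule DERIV_cong)
    show "((\<lambda>t. inverse t ^ n / exp (inverse t)) has_real_derivative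
        (real n * inverse t ^ (n - 1) * - (inverse t * inverse t) * exp (inverse t)
          - inverse t ^ n * (exp (inverse t) * - (inverse t * inverse t)))
        / (exp (inverse t) * exp (inverse t))) (at t)"
      using greater by (auto intro!: derivative_eq_intros)
    \<comment> \<open>For \<open>n = 0\<close> the exponent \<open>n - 1\<close> is truncated to 0,
      but the factor \<open>real n\<close> vanishes.\<close>
    have "real n * inverse t ^ (n - 1) * inverse t = real n * inverse t ^ n"
      by (cases n) auto
    then show "(real n * inverse t ^ (n - 1) * - (inverse t * inverse t) * exp (inverse t)
          - inverse t ^ n * (exp (inverse t) * - (inverse t * inverse t)))
        / (exp (inverse t) * exp (inverse t))
      = flat_exp (n + 2) t - real n * flat_exp (n + 1) t"
      using greater by (simp add: flat_exp_def divide_simps) (auto simp: algebra_simps)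
  qed
  then show ?thesis
    by (rule has_field_derivative_transform_within_open[of _ _ _ "{0<..}"])
       (use greater in \<open>auto simp: flat_exp_def\<close>)
qed

lemma smooth_on_flat_exp: "smooth_on (flat_exp n) S"
proof (rule smooth_onI)
  fix k
  have "Ck_on k (flat_exp n) UNIV"
  proof (induction k arbitrary: n)
    case 0
    show ?case
      using DERIV_isCont[OF flat_exp_deriv] by (simp add: continuous_at_imp_continuous_on)
  next
    case (Suc k)
    have "frechet_derivative (flat_exp n) (at t) v
        = (flat_exp (n + 2) t + (- real n) * flat_exp (n + 1) t) * v" for t v
      using frechet_derivative_at[OF flat_exp_deriv[of n t, unfolded has_field_derivative_def]]
      by (metis (no_types, lifting) add_uminus_conv_diff mult_minus_left)
    moreover have "Ck_on k (\<lambda>t. (flat_exp (n + 2) t + (- real n) * flat_exp (n + 1) t) * v) UNIV" for v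
      by (intro Ck_on_mult Ck_on_add Ck_on_const Suc.IH open_UNIV)
    moreover have "flat_exp n differentiable at t" for t
      using flat_exp_deriv[of n t] unfolding differentiable_def has_field_derivative_def by blast
    ultimately show ?case by simp
  qed
  then show "Ck_on k (flat_exp n) S" using Ck_on_subset by blast
qed

lemma bump_function:
  fixes a :: "'a::euclidean_space"
  assumes "r > 0"
  obtains \<psi> :: "'a \<Rightarrow> real"
  where "smooth_on \<psi> UNIV" "\<psi> a = 1" "\<And>x. x \<notin> cball a r \<Longrightarrow> \<psi> x = 0"
proof
  \<comment> \<open>The argument of \<open>flat_exp\<close> is negative outside the ball, and the
    quotient makes the value at \<open>a\<close> equal to 1. Differences are written as sums and
    scalings to match the closure lemmas.\<close>
  define \<psi> where "\<psi> x = (1 / flat_exp 0 (r\<^sup>2)) *\<^sub>R flat_exp 0 (r\<^sup>2 + (- 1) *\<^sub>R ((x + - a) \<bullet> (x + - a)))" for x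
  have "smooth_on (\<lambda>x. r\<^sup>2 + (- 1) *\<^sub>R ((x + - a) \<bullet> (x + - a))) UNIV"
    by (intro smooth_on_add smooth_on_scaleR smooth_on_inner smooth_on_ident smooth_on_const open_UNIV)
  then have "smooth_on (\<lambda>x. flat_exp 0 (r\<^sup>2 + (- 1) *\<^sub>R ((x + - a) \<bullet> (x + - a)))) UNIV"
    by (rule smooth_on_compose[OF open_UNIV open_UNIV subset_UNIV _ smooth_on_flat_exp])
  then show "smooth_on \<psi> UNIV"
    unfolding \<psi>_def by (rule smooth_on_scaleR[OF open_UNIV smooth_on_const])
  have "flat_exp 0 (r\<^sup>2) \<noteq> 0" using assms by (simp add: flat_exp_def)
  then show "\<psi> a = 1" by (simp add: \<psi>_def)
  show "\<psi> x = 0" if "x \<notin> cball a r" for x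
  proof -
    have "r < norm (x - a)" using that by (simp add: dist_norm norm_minus_commute)
    then have "r\<^sup>2 < (norm (x - a))\<^sup>2" using assms by (intro power_strict_mono) auto
    then show ?thesis by (simp add: \<psi>_def flat_exp_def dot_square_norm)
  qed
qed

section \<open>Charts, tangent vectors and vector fields\<close>

lemma comp_tvec [simp]:
  "comp (v + w) c = comp v c + comp w c"
  "comp (v - w) c = comp v c - comp w c"
  "comp (- v) c = - comp v c"
  "comp (a *\<^sub>R v) c = a *\<^sub>R comp v c"
  "comp 0 c = 0"
  by (simp_all add: zero_tvec_def plus_tvec_def uminus_tvec_def minus_tvec_def scaleR_tvec_def)

section \<open>Charts, transition maps and their Jacobians\<close>

locale smooth_mfd =
  fixes T :: "'m topology" and A :: "('m, 'e::euclidean_space) chart set"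
  assumes mfd: "smooth_manifold T A"
begin

lemma openin_chart: "c \<in> A \<Longrightarrow> openin T (fst c)"
  using mfd by (simp add: smooth_manifold_def smooth_atlas_def)

lemma chart_exists: "p \<in> topspace T \<Longrightarrow> \<exists>c\<in>A. p \<in> fst c"
  using mfd by (force simp: smooth_manifold_def smooth_atlas_def)

lemma homeo_chart:
  "c \<in> A \<Longrightarrow> homeomorphic_map (subtopology T (fst c)) (top_of_set (snd c ` fst c)) (snd c)"
  using mfd by (simp add: smooth_manifold_def smooth_atlas_def)

lemma topspace_chart: "c \<in> A \<Longrightarrow> topspace (subtopology T (fst c)) = fst c"
  using openin_subset[OF openin_chart] by (simp add: topspace_subtopology Int_absorb1)

lemma inj_chart: "c \<in> A \<Longrightarrow> inj_on (snd c) (fst c)"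
  using homeo_chart homeomorphic_imp_injective_map topspace_chart by metis

lemma chart_inv_chart [simp]: "c \<in> A \<Longrightarrow> q \<in> fst c \<Longrightarrow> chart_inv c (snd c q) = q"
  using inj_chart by (simp add: chart_inv_def)

lemma transition_chart [simp]: "c \<in> A \<Longrightarrow> q \<in> fst c \<Longrightarrow> transition c d (snd c q) = snd d q"
  by (simp add: transition_def)

lemma chart_imageI: "q \<in> fst c \<Longrightarrow> q \<in> U \<Longrightarrow> snd c q \<in> chart_image c U"
  by (simp add: chart_image_def)

lemma chart_imageE:
  assumes "x \<in> chart_image c U"
  obtains q where "q \<in> fst c" "q \<in> U" "x = snd c q"
  using assms by (auto simp: chart_image_def)

lemma open_chart_image:
  assumes "c \<in> A" "openin T U"
  shows "open (chart_image c U)"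
proof -
  have "openin (subtopology T (fst c)) (fst c \<inter> U)"
    using assms(2) by (metis Int_commute openin_subtopology_Int)
  then have "openin (top_of_set (snd c ` fst c)) (snd c ` (fst c \<inter> U))"
    using homeomorphic_imp_open_map[OF homeo_chart[OF assms(1)]] by (auto simp: open_map_def)
  moreover have "open (snd c ` fst c)"
    using mfd assms(1) by (simp add: smooth_manifold_def smooth_atlas_def)
  ultimately show ?thesis
    by (simp add: chart_image_def openin_open_eq)
qed

lemma smooth_on_transition:
  "c \<in> A \<Longrightarrow> d \<in> A \<Longrightarrow> smooth_on (transition c d) (chart_image c (fst d))"
  using mfd by (simp add: smooth_manifold_def smooth_atlas_def)

definition Jac :: "('m, 'e) chart \<Rightarrow> ('m, 'e) chart \<Rightarrow> 'm \<Rightarrow> 'e \<Rightarrow> 'e" where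
  "Jac c d q = frechet_derivative (transition c d) (at (snd c q))"

lemma transition_has_derivative:
  assumes "c \<in> A" "d \<in> A" "q \<in> fst c" "q \<in> fst d"
  shows "(transition c d has_derivative Jac c d q) (at (snd c q))"
  unfolding Jac_def frechet_derivative_works[symmetric]
  by (rule smooth_on_differentiable[OF smooth_on_transition])
     (use assms in \<open>auto intro: chart_imageI\<close>)

lemma linear_Jac: "c \<in> A \<Longrightarrow> d \<in> A \<Longrightarrow> q \<in> fst c \<Longrightarrow> q \<in> fst d \<Longrightarrow> linear (Jac c d q)"
  using transition_has_derivative has_derivative_linear by blast

text \<open>Chain rule: \<open>transition d e\<close> after \<open>transition c d\<close> coincides
  with \<open>transition c e\<close> on the open set \<open>chart_image c (fst d)\<close>.\<close>

lemma Jac_chain: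
  assumes "c \<in> A" "d \<in> A" "e \<in> A" "q \<in> fst c" "q \<in> fst d" "q \<in> fst e"
  shows "Jac d e q (Jac c d q w) = Jac c e q w"
proof -
  have "((\<lambda>x. transition d e (transition c d x)) has_derivative (\<lambda>w. Jac d e q (Jac c d q w)))
      (at (snd c q))"
    using assms transition_has_derivative
    by (intro has_derivative_compose[of "transition c d" _ _ UNIV "transition d e"]) auto
  then have "(transition c e has_derivative (\<lambda>w. Jac d e q (Jac c d q w))) (at (snd c q))"
  proof (rule has_derivative_transform_within_open)
    show "open (chart_image c (fst d))"
      using assms open_chart_image openin_chart by blast
  qed (use assms in \<open>auto intro: chart_imageI elim: chart_imageE\<close>)
  from has_derivative_unique[OF this transition_has_derivative[of c e q]] assms
  show ?thesis by metis
qed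

lemma Jac_self:
  assumes "c \<in> A" "q \<in> fst c"
  shows "Jac c c q w = w"
proof -
  have "(transition c c has_derivative (\<lambda>w. w)) (at (snd c q))"
  proof (rule has_derivative_transform_within_open[of "\<lambda>x. x"])
    show "open (chart_image c (fst c))"
      using assms open_chart_image openin_chart by blast
  qed (use assms in \<open>auto intro: chart_imageI elim: chart_imageE\<close>)
  from has_derivative_unique[OF this transition_has_derivative[of c c q]] assms
  show ?thesis by metis
qed

section \<open>Tangent spaces in coordinates\<close>

lemma comp_chart_change:
  assumes "v \<in> tangent_space A p" "c \<in> A" "d \<in> A" "p \<in> fst c" "p \<in> fst d"
  shows "comp v d = Jac c d p (comp v c)"
  using assms unfolding tangent_space_def Jac_def by blast

lemma tangent_spaceI:
  assumes "\<And>c. \<not> (c \<in> A \<and> p \<in> fst c) \<Longrightarrow> comp v c = 0"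
    and "\<And>c d. c \<in> A \<Longrightarrow> d \<in> A \<Longrightarrow> p \<in> fst c \<Longrightarrow> p \<in> fst d \<Longrightarrow> comp v d = Jac c d p (comp v c)"
  shows "v \<in> tangent_space A p"
  using assms unfolding tangent_space_def Jac_def by blast

lemma comp_outside: "v \<in> tangent_space A p \<Longrightarrow> \<not> (c \<in> A \<and> p \<in> fst c) \<Longrightarrow> comp v c = 0"
  unfolding tangent_space_def by blast

lemma subspace_tangent_space: "subspace (tangent_space A p)"
proof (rule subspaceI)
  show "0 \<in> tangent_space A p"
    by (rule tangent_spaceI) (simp_all add: linear_0[OF linear_Jac])
  show "v + w \<in> tangent_space A p" if "v \<in> tangent_space A p" "w \<in> tangent_space A p" for v w
    using that
    by (intro tangent_spaceI) (simp_all add: linear_add[OF linear_Jac] comp_outside comp_chart_change[symmetric])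
  show "a *\<^sub>R v \<in> tangent_space A p" if "v \<in> tangent_space A p" for a v
    using that
    by (intro tangent_spaceI) (simp_all add: linear_scale[OF linear_Jac] comp_outside comp_chart_change[symmetric])
qed

lemma tangent_space_eqI:
  assumes "v \<in> tangent_space A p" "w \<in> tangent_space A p" "c \<in> A" "p \<in> fst c"
    and "comp v c = comp w c"
  shows "v = w"
proof (rule tvec.expand, rule ext)
  fix d
  show "comp v d = comp w d"
  proof (cases "d \<in> A \<and> p \<in> fst d")
    case True
    then show ?thesis using comp_chart_change[OF assms(1), of c d] comp_chart_change[OF assms(2), of c d] assms(3-5)
      by simp
  next
    case False
    then show ?thesis using assms(1,2) by (simp add: comp_outside)
  qed
qed

text \<open>For a chart \<open>c\<close> around \<open>q\<close> this is the inverse of the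
  coordinate isomorphism taking \<open>v\<close> to \<open>comp v c\<close>; the value 0 elsewhere
  is the normalisation that \<open>tangent_space\<close> demands.\<close>

definition tangent_of :: "('m, 'e) chart \<Rightarrow> 'm \<Rightarrow> 'e \<Rightarrow> ('m, 'e) tvec" where
  "tangent_of c q w = TVec (\<lambda>d. if d \<in> A \<and> q \<in> fst d then Jac c d q w else 0)"

lemma comp_tangent_of:
  "comp (tangent_of c q w) d = (if d \<in> A \<and> q \<in> fst d then Jac c d q w else 0)"
  by (simp add: tangent_of_def)

lemma tangent_of_in: "c \<in> A \<Longrightarrow> q \<in> fst c \<Longrightarrow> tangent_of c q w \<in> tangent_space A q"
  by (rule tangent_spaceI) (auto simp: comp_tangent_of Jac_chain)

section \<open>Smooth functions and vector fields over an open set\<close>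

lemma smooth_functionI:
  "(\<And>c. c \<in> A \<Longrightarrow> smooth_on (\<lambda>x. f (chart_inv c x)) (chart_image c U)) \<Longrightarrow> smooth_function A U f"
  by (simp add: smooth_function_def o_def)

lemma smooth_functionD:
  "smooth_function A U f \<Longrightarrow> c \<in> A \<Longrightarrow> smooth_on (\<lambda>x. f (chart_inv c x)) (chart_image c U)"
  by (simp add: smooth_function_def o_def)

lemma vector_fieldsI:
  "(\<And>p. p \<in> U \<Longrightarrow> X p \<in> tangent_space A p) \<Longrightarrow>
   (\<And>c. c \<in> A \<Longrightarrow> smooth_on (\<lambda>x. comp (X (chart_inv c x)) c) (chart_image c U)) \<Longrightarrow>
   X \<in> vector_fields A U"
  by (simp add: vector_fields_def)

lemma vector_fieldsD:
  assumes "X \<in> vector_fields A U"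
  shows "p \<in> U \<Longrightarrow> X p \<in> tangent_space A p"
    and "c \<in> A \<Longrightarrow> smooth_on (\<lambda>x. comp (X (chart_inv c x)) c) (chart_image c U)"
  using assms by (simp_all add: vector_fields_def)

lemma smooth_function_const: "smooth_function A U (\<lambda>q. k)"
  by (simp add: smooth_functionI smooth_on_const)

lemma smooth_function_subset: "smooth_function A U f \<Longrightarrow> V \<subseteq> U \<Longrightarrow> smooth_function A V f"
  by (rule smooth_functionI, rule smooth_on_subset, erule (1) smooth_functionD)
     (auto simp: chart_image_def)

lemma smooth_function_cong:
  assumes "openin T U" "\<And>q. q \<in> U \<Longrightarrow> f q = h q" "smooth_function A U f"
  shows "smooth_function A U h"
proof (rule smooth_functionI)
  fix c assume c: "c \<in> A"
  show "smooth_on (\<lambda>x. h (chart_inv c x)) (chart_image c U)"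
    by (rule smooth_on_cong[OF open_chart_image[OF c assms(1)] _ smooth_functionD[OF assms(3) c]])
       (use c assms(2) in \<open>auto elim!: chart_imageE\<close>)
qed

lemma smooth_function_cmult:
  assumes "openin T U" "smooth_function A U f"
  shows "smooth_function A U (\<lambda>q. a * f q)"
proof (rule smooth_functionI)
  fix c assume c: "c \<in> A"
  have "smooth_on (\<lambda>x. a *\<^sub>R f (chart_inv c x)) (chart_image c U)"
    by (intro smooth_on_scaleR[OF open_chart_image[OF c assms(1)] smooth_on_const]
        smooth_functionD[OF assms(2) c])
  then show "smooth_on (\<lambda>x. a * f (chart_inv c x)) (chart_image c U)" by simp
qed

lemma vector_fields_subset: "X \<in> vector_fields A U \<Longrightarrow> V \<subseteq> U \<Longrightarrow> X \<in> vector_fields A V"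
  by (rule vector_fieldsI, blast dest: vector_fieldsD, rule smooth_on_subset, erule (1) vector_fieldsD)
     (auto simp: chart_image_def)

lemma vector_fields_cong:
  assumes "openin T U" "\<And>q. q \<in> U \<Longrightarrow> X q = Y q" "X \<in> vector_fields A U"
  shows "Y \<in> vector_fields A U"
proof (rule vector_fieldsI)
  show "Y p \<in> tangent_space A p" if "p \<in> U" for p
    using assms that vector_fieldsD(1) by metis
  fix c assume c: "c \<in> A"
  show "smooth_on (\<lambda>x. comp (Y (chart_inv c x)) c) (chart_image c U)"
    by (rule smooth_on_cong[OF open_chart_image[OF c assms(1)] _ vector_fieldsD(2)[OF assms(3) c]])
       (use c assms(2) in \<open>auto elim!: chart_imageE\<close>)
qed

lemma vector_fields_add:
  assumes "openin T U" "X \<in> vector_fields A U" "Y \<in> vector_fields A U"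
  shows "(\<lambda>q. X q + Y q) \<in> vector_fields A U"
proof (rule vector_fieldsI)
  show "X p + Y p \<in> tangent_space A p" if "p \<in> U" for p
    using assms that by (intro subspace_add[OF subspace_tangent_space] vector_fieldsD(1))
  show "smooth_on (\<lambda>x. comp (X (chart_inv c x) + Y (chart_inv c x)) c) (chart_image c U)"
    if "c \<in> A" for c
    unfolding comp_tvec using assms that
    by (intro smooth_on_add open_chart_image vector_fieldsD(2))
qed

lemma vector_fields_scaleR:
  assumes "openin T U" "smooth_function A U f" "X \<in> vector_fields A U"
  shows "(\<lambda>q. f q *\<^sub>R X q) \<in> vector_fields A U"
proof (rule vector_fieldsI)
  show "f p *\<^sub>R X p \<in> tangent_space A p" if "p \<in> U" for p
    using assms that by (intro subspace_scale[OF subspace_tangent_space] vector_fieldsD(1))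
  show "smooth_on (\<lambda>x. comp (f (chart_inv c x) *\<^sub>R X (chart_inv c x)) c) (chart_image c U)"
    if "c \<in> A" for c
    unfolding comp_tvec using assms that
    by (intro smooth_on_scaleR open_chart_image smooth_functionD vector_fieldsD(2))
qed

lemma vector_fields_uminus:
  assumes "openin T U" "X \<in> vector_fields A U"
  shows "(\<lambda>q. - X q) \<in> vector_fields A U"
  using vector_fields_scaleR[OF assms(1) smooth_function_const[of _ "-1"] assms(2)] by simp

lemma vector_fields_diff:
  assumes "openin T U" "X \<in> vector_fields A U" "Y \<in> vector_fields A U"
  shows "(\<lambda>q. X q - Y q) \<in> vector_fields A U"
  using vector_fields_add[OF assms(1,2) vector_fields_uminus[OF assms(1,3)]] by simp

section \<open>Derivatives of functions along vector fields\<close>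

lemma local_differentiable:
  assumes "openin T U" "smooth_function A U f" "c \<in> A" "p \<in> U" "p \<in> fst c"
  shows "(\<lambda>x. f (chart_inv c x)) differentiable at (snd c p)"
  using smooth_on_differentiable[OF smooth_functionD[OF assms(2,3)] chart_imageI] assms(4,5) by simp

lemma chart_at:
  assumes "p \<in> topspace T"
  shows "chart_at A p \<in> A" "p \<in> fst (chart_at A p)"
  using someI_ex[of "\<lambda>c. c \<in> A \<and> p \<in> fst c"] chart_exists[OF assms]
  unfolding chart_at_def by blast+

text \<open>\<open>field_deriv\<close> uses the arbitrary chart \<open>chart_at A p\<close>. Passing
  to \<open>c\<close> composes the function with a transition map and changes the components of
  \<open>X p\<close> by \<open>Jac\<close>; the chain rule matches the two changes.\<close>

lemma field_deriv_chart:
  assumes U: "openin T U" and f: "smooth_function A U f" and p: "p \<in> U"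
    and X: "X p \<in> tangent_space A p" and c: "c \<in> A" "p \<in> fst c"
  shows "field_deriv A X f p
    = frechet_derivative (\<lambda>x. f (chart_inv c x)) (at (snd c p)) (comp (X p) c)"
proof -
  define d where "d = chart_at A p"
  have d: "d \<in> A" "p \<in> fst d"
    using chart_at p openin_subset[OF U] by (auto simp: d_def)
  have "((\<lambda>x. f (chart_inv c x)) has_derivative
      frechet_derivative (\<lambda>x. f (chart_inv c x)) (at (snd c p))) (at (snd c p))"
    using local_differentiable[OF U f c(1) p c(2)] by (simp add: frechet_derivative_works[symmetric])
  then have "((\<lambda>y. f (chart_inv c (transition d c y))) has_derivative
      (\<lambda>w. frechet_derivative (\<lambda>x. f (chart_inv c x)) (at (snd c p)) (Jac d c p w))) (at (snd d p))"
    using transition_has_derivative[of d c p] c d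
    by (intro has_derivative_compose[of "transition d c" _ _ UNIV "\<lambda>x. f (chart_inv c x)"]) auto
  then have "((\<lambda>y. f (chart_inv d y)) has_derivative
      (\<lambda>w. frechet_derivative (\<lambda>x. f (chart_inv c x)) (at (snd c p)) (Jac d c p w))) (at (snd d p))"
  proof (rule has_derivative_transform_within_open)
    show "open (chart_image d (fst c))"
      using c d open_chart_image openin_chart by blast
  qed (use c d in \<open>auto intro: chart_imageI elim: chart_imageE\<close>)
  from frechet_derivative_at[OF this, symmetric]
  show ?thesis
    using comp_chart_change[OF X d(1) c(1) d(2) c(2)]
    by (simp add: field_deriv_def d_def[symmetric] o_def Let_def)
qed

lemma field_deriv_cong:
  assumes U: "openin T U" and "smooth_function A U f" "p \<in> U" "\<And>q. q \<in> U \<Longrightarrow> f q = h q"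
  shows "field_deriv A X f p = field_deriv A X h p"
proof -
  define c where "c = chart_at A p"
  have c: "c \<in> A" "p \<in> fst c"
    using chart_at assms(3) openin_subset[OF U] by (auto simp: c_def)
  have "frechet_derivative (\<lambda>x. f (chart_inv c x)) (at (snd c p))
      = frechet_derivative (\<lambda>x. h (chart_inv c x)) (at (snd c p))"
    by (rule frechet_derivative_transform_within_open[OF local_differentiable[OF assms(1,2) c(1) assms(3) c(2)]
          open_chart_image[OF c(1) U]])
       (use c assms in \<open>auto intro: chart_imageI elim!: chart_imageE\<close>)
  then show ?thesis by (simp add: field_deriv_def c_def[symmetric] o_def Let_def)
qed

lemma field_deriv_const: "field_deriv A X (\<lambda>q. k) p = 0"
  by (simp add: field_deriv_def o_def Let_def)

lemma field_deriv_exp_mult: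
  assumes "openin T U" "smooth_function A U f" "smooth_function A U h" "p \<in> U"
  shows "field_deriv A X (\<lambda>q. exp (2 * f q) * h q) p
    = exp (2 * f p) * (2 * field_deriv A X f p * h p + field_deriv A X h p)"
proof -
  define c where "c = chart_at A p"
  have c: "c \<in> A" "p \<in> fst c"
    using chart_at assms(4) openin_subset[OF assms(1)] by (auto simp: c_def)
  let ?f = "\<lambda>x. f (chart_inv c x)" and ?h = "\<lambda>x. h (chart_inv c x)" and ?x = "snd c p"
  have "(?f has_derivative frechet_derivative ?f (at ?x)) (at ?x)"
       "(?h has_derivative frechet_derivative ?h (at ?x)) (at ?x)"
    using local_differentiable[OF assms(1) _ c(1) assms(4) c(2)] assms(2,3)
    by (simp_all add: frechet_derivative_works[symmetric])
  then have "((\<lambda>x. exp (2 * ?f x) * ?h x) has_derivative (\<lambda>v. exp (2 * f p) *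
      (2 * frechet_derivative ?f (at ?x) v * h p + frechet_derivative ?h (at ?x) v))) (at ?x)"
    using c by (auto intro!: derivative_eq_intros simp: algebra_simps)
  from frechet_derivative_at[OF this, symmetric] show ?thesis
    by (simp add: field_deriv_def c_def[symmetric] o_def Let_def)
qed

text \<open>In a chart \<open>X f\<close> is the sum of the components of \<open>X\<close> times the
  partial derivatives of \<open>f\<close>, all of them smooth.\<close>

lemma smooth_function_field_deriv:
  assumes U: "openin T U" and f: "smooth_function A U f" and X: "X \<in> vector_fields A U"
  shows "smooth_function A U (field_deriv A X f)"
proof (rule smooth_functionI)
  fix c assume c: "c \<in> A"
  let ?f = "\<lambda>x. f (chart_inv c x)" and ?X = "\<lambda>x. comp (X (chart_inv c x)) c"
  note o = open_chart_image[OF c U]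
  have "smooth_on (\<lambda>x. \<Sum>i\<in>Basis. (?X x \<bullet> i) *\<^sub>R frechet_derivative ?f (at x) i) (chart_image c U)"
    by (intro smooth_on_sum smooth_on_scaleR smooth_on_inner smooth_on_const smooth_on_deriv
        smooth_functionD[OF f c] vector_fieldsD(2)[OF X c] o) auto
  then show "smooth_on (\<lambda>x. field_deriv A X f (chart_inv c x)) (chart_image c U)"
  proof (rule smooth_on_cong[OF o, rotated])
    fix x assume "x \<in> chart_image c U"
    then obtain q where q: "q \<in> fst c" "q \<in> U" "x = snd c q" by (rule chart_imageE)
    have "field_deriv A X f q = frechet_derivative ?f (at x) (?X x)"
      using field_deriv_chart[of U f q X c, OF U f q(2) vector_fieldsD(1)[OF X q(2)] c q(1)] c q by simp
    also have "\<dots> = (\<Sum>i\<in>Basis. (?X x \<bullet> i) *\<^sub>R frechet_derivative ?f (at x) i)"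
      using local_differentiable[OF U f c q(2,1)] q(3)
      by (intro linear_sum_Basis linear_frechet_derivative) simp
    finally show "(\<Sum>i\<in>Basis. (?X x \<bullet> i) *\<^sub>R frechet_derivative ?f (at x) i)
        = field_deriv A X f (chart_inv c x)"
      using c q by simp
  qed
qed

text \<open>Cutting off with a bump function: the Hausdorff property makes the closed coordinate ball closed
  in the manifold, so that the extension by zero is smooth.\<close>

lemma vector_field_extending:
  assumes p: "p \<in> topspace T" and v: "v \<in> tangent_space A p"
  obtains X where "X \<in> vector_fields A (topspace T)" "X p = v"
proof -
  obtain c where c: "c \<in> A" "p \<in> fst c" using chart_exists[OF p] by blast
  define S where "S = snd c ` fst c"
  have "open S" using mfd c(1) by (simp add: S_def smooth_manifold_def smooth_atlas_def)
  then obtain r where r: "r > 0" "cball (snd c p) r \<subseteq> S"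
    using c(2) open_contains_cball by (metis S_def imageI)
  obtain \<psi> :: "'e \<Rightarrow> real" where \<psi>: "smooth_on \<psi> UNIV" "\<psi> (snd c p) = 1"
    "\<And>x. x \<notin> cball (snd c p) r \<Longrightarrow> \<psi> x = 0"
    using bump_function[OF r(1)] by blast
  define K where "K = chart_inv c ` cball (snd c p) r"
  have K: "K = {q \<in> fst c. snd c q \<in> cball (snd c p) r}"
  proof (intro equalityI subsetI)
    fix q assume "q \<in> K"
    then obtain x where x: "x \<in> cball (snd c p) r" "q = chart_inv c x" by (auto simp: K_def)
    then have "x \<in> S" using r(2) by blast
    then show "q \<in> {q \<in> fst c. snd c q \<in> cball (snd c p) r}"
      using x c(1) by (auto simp: S_def)
  next
    fix q assume q: "q \<in> {q \<in> fst c. snd c q \<in> cball (snd c p) r}"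
    then have "q = chart_inv c (snd c q)" using c(1) by simp
    then show "q \<in> K" using q unfolding K_def by blast
  qed
  have "closedin T K"
  proof (rule compactin_imp_closedin)
    show "Hausdorff_space T" using mfd by (simp add: smooth_manifold_def)
    \<comment> \<open>The continuous inverse \<open>h\<close> of the chart agrees with
      \<open>chart_inv c\<close> on \<open>S\<close>, so \<open>K\<close> is the continuous image of
      a compact ball.\<close>
    obtain h where h: "homeomorphic_maps (subtopology T (fst c)) (top_of_set S) (snd c) h"
      using homeo_chart[OF c(1)] homeomorphic_map_maps unfolding S_def by blast
    have hx: "h x = chart_inv c x" if x: "x \<in> S" for x
    proof -
      obtain q where "q \<in> fst c" "x = snd c q" using x by (auto simp: S_def)
      then show ?thesis
        using h c(1) topspace_chart[OF c(1)] by (simp add: homeomorphic_maps_def)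
    qed
    have "compactin (top_of_set S) (cball (snd c p) r)"
      using r(2) by (simp add: compactin_subtopology)
    moreover have "continuous_map (top_of_set S) (subtopology T (fst c)) h"
      using h by (simp add: homeomorphic_maps_def)
    ultimately have "compactin (subtopology T (fst c)) (h ` cball (snd c p) r)"
      by (rule image_compactin)
    moreover have "h ` cball (snd c p) r = K"
      unfolding K_def using hx r(2) by (intro image_cong) auto
    ultimately show "compactin T K" by (simp add: compactin_subtopology)
  qed
  \<comment> \<open>In the chart \<open>c\<close> this is the constant field with the components of
    \<open>v\<close>, cut off by \<open>\<psi>\<close>; as \<open>\<psi>\<close> is 1 at the centre,
    the value at \<open>p\<close> is \<open>v\<close>.\<close>
  define X where "X q = (if q \<in> fst c then tangent_of c q (\<psi> (snd c q) *\<^sub>R comp v c) else 0)" for q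
  have zero: "X q = 0" if "q \<in> topspace T" "q \<notin> K" for q
  proof (cases "q \<in> fst c")
    case True
    then have "\<psi> (snd c q) = 0" using that K \<psi>(3) by blast
    then show ?thesis
      using True by (auto intro!: tvec.expand ext simp: X_def comp_tangent_of linear_0[OF linear_Jac] c)
  qed (simp add: X_def)
  have "X \<in> vector_fields A (topspace T)"
  proof (rule vector_fieldsI)
    show "X q \<in> tangent_space A q" if "q \<in> topspace T" for q
      using c tangent_of_in subspace_0[OF subspace_tangent_space] by (simp add: X_def)
    fix d assume d: "d \<in> A"
    show "smooth_on (\<lambda>x. comp (X (chart_inv d x)) d) (chart_image d (topspace T))"
    proof (rule smooth_on_local)
      fix x assume "x \<in> chart_image d (topspace T)"
      then obtain q where q: "q \<in> fst d" "q \<in> topspace T" "x = snd d q" by (rule chart_imageE)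
      show "\<exists>R. open R \<and> x \<in> R \<and> smooth_on (\<lambda>x. comp (X (chart_inv d x)) d) R"
      \<comment> \<open>The open sets \<open>fst c\<close> and \<open>topspace T - K\<close> cover
        the manifold: on the first the field has a smooth coordinate expression, on the second it is
        zero.\<close>
      proof (cases "q \<in> fst c")
        case True
        let ?R = "chart_image d (fst c)"
        have R: "open ?R" using open_chart_image d c openin_chart by blast
        have R': "open (chart_image c (fst d))" using open_chart_image d c openin_chart by blast
        \<comment> \<open>The \<open>d\<close>-components of \<open>X\<close> as a function of the
          \<open>c\<close>-coordinates; composing with \<open>transition d c\<close> then returns to
          the \<open>d\<close>-coordinates.\<close>
        have "smooth_on (\<lambda>y. \<Sum>i\<in>Basis. ((\<psi> y *\<^sub>R comp v c) \<bullet> i) *\<^sub>R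
            frechet_derivative (transition c d) (at y) i) (chart_image c (fst d))"
          by (intro smooth_on_sum smooth_on_scaleR smooth_on_inner smooth_on_const R' finite_Basis
              smooth_on_deriv[OF smooth_on_transition[OF c(1) d]] smooth_on_subset[OF \<psi>(1)]) auto
        then have s: "smooth_on (\<lambda>x. (\<lambda>y. \<Sum>i\<in>Basis. ((\<psi> y *\<^sub>R comp v c) \<bullet> i) *\<^sub>R
            frechet_derivative (transition c d) (at y) i) (transition d c x)) ?R"
          using d c(1) by (intro smooth_on_compose[OF R R' _ smooth_on_transition[OF d c(1)]])
             (auto elim!: chart_imageE intro: chart_imageI)
        have "smooth_on (\<lambda>x. comp (X (chart_inv d x)) d) ?R"
        proof (rule smooth_on_cong[OF R _ s])
          fix y assume "y \<in> ?R"
          then obtain q' where q': "q' \<in> fst d" "q' \<in> fst c" "y = snd d q'" by (rule chart_imageE)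
          have "comp (X q') d = Jac c d q' (\<psi> (snd c q') *\<^sub>R comp v c)"
            using q' d by (simp add: X_def comp_tangent_of)
          then show "(\<Sum>i\<in>Basis. ((\<psi> (transition d c y) *\<^sub>R comp v c) \<bullet> i) *\<^sub>R
              frechet_derivative (transition c d) (at (transition d c y)) i)
            = comp (X (chart_inv d y)) d"
            unfolding linear_sum_Basis[OF linear_Jac[OF c(1) d q'(2,1)], of "\<psi> (snd c q') *\<^sub>R comp v c"]
            using q' d by (simp add: Jac_def)
        qed
        moreover have "x \<in> ?R" using q True by (auto intro: chart_imageI)
        ultimately show ?thesis using R by (intro exI[of _ ?R] conjI)
      next
        case False
        let ?R = "chart_image d (topspace T - K)"
        have R: "open ?R" using open_chart_image[OF d] \<open>closedin T K\<close> by blast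
        have "smooth_on (\<lambda>x. comp (X (chart_inv d x)) d) ?R"
          by (rule smooth_on_cong[OF R _ smooth_on_const[of 0]])
             (use d zero in \<open>auto elim!: chart_imageE\<close>)
        moreover have "x \<in> ?R" using q False K by (auto intro: chart_imageI)
        ultimately show ?thesis using R by (intro exI[of _ ?R] conjI)
      qed
    qed
  qed
  moreover have "X p = v"
  proof (rule tangent_space_eqI[OF _ v c])
    show "X p \<in> tangent_space A p" using c tangent_of_in by (simp add: X_def)
    show "comp (X p) c = comp v c" using c \<psi>(2) by (simp add: X_def comp_tangent_of Jac_self)
  qed
  ultimately show ?thesis by (rule that)
qed

end

section \<open>Linear algebra at a point\<close>

text \<open>The structure on one tangent space, isolated from the manifold. \<open>V\<close> is a
  subspace rather than the whole type, since the tensors are constrained only on tangent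
  vectors.\<close>

locale paracontact_space =
  fixes V :: "'v::real_vector set" and \<phi> :: "'v \<Rightarrow> 'v" and \<eta> :: "'v \<Rightarrow> real" and \<xi> :: 'v
    and g :: "'v \<Rightarrow> 'v \<Rightarrow> real"
  assumes subspace_V: "subspace V"
    and phi_closed: "v \<in> V \<Longrightarrow> \<phi> v \<in> V"
    and phi_linear: "v \<in> V \<Longrightarrow> w \<in> V \<Longrightarrow> \<phi> (a *\<^sub>R v + b *\<^sub>R w) = a *\<^sub>R \<phi> v + b *\<^sub>R \<phi> w"
    and eta_linear: "v \<in> V \<Longrightarrow> w \<in> V \<Longrightarrow> \<eta> (a *\<^sub>R v + b *\<^sub>R w) = a * \<eta> v + b * \<eta> w"
    and g_linear: "u \<in> V \<Longrightarrow> v \<in> V \<Longrightarrow> w \<in> V \<Longrightarrow> g (a *\<^sub>R u + b *\<^sub>R v) w = a * g u w + b * g v w"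
    and g_sym: "v \<in> V \<Longrightarrow> w \<in> V \<Longrightarrow> g v w = g w v"
    and g_nondegenerate: "v \<in> V \<Longrightarrow> (\<And>w. w \<in> V \<Longrightarrow> g v w = 0) \<Longrightarrow> v = 0"
    and xi_closed: "\<xi> \<in> V"
    and phi_xi: "\<phi> \<xi> = 0"
    and eta_xi: "\<eta> \<xi> = 1"
    and eta_phi: "v \<in> V \<Longrightarrow> \<eta> (\<phi> v) = 0"
    and phi_phi: "v \<in> V \<Longrightarrow> \<phi> (\<phi> v) = v - \<eta> v *\<^sub>R \<xi>"
    and g_phi_phi: "v \<in> V \<Longrightarrow> w \<in> V \<Longrightarrow> g (\<phi> v) (\<phi> w) = - g v w + \<eta> v * \<eta> w"
begin

lemma closed:
  "0 \<in> V" "v \<in> V \<Longrightarrow> w \<in> V \<Longrightarrow> v + w \<in> V" "v \<in> V \<Longrightarrow> w \<in> V \<Longrightarrow> v - w \<in> V"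
  "v \<in> V \<Longrightarrow> - v \<in> V" "v \<in> V \<Longrightarrow> a *\<^sub>R v \<in> V"
  using subspace_V by (simp_all add: subspace_0 subspace_add subspace_diff subspace_neg subspace_scale)

lemma phi_hom:
  "v \<in> V \<Longrightarrow> w \<in> V \<Longrightarrow> \<phi> (v + w) = \<phi> v + \<phi> w"
  "v \<in> V \<Longrightarrow> w \<in> V \<Longrightarrow> \<phi> (v - w) = \<phi> v - \<phi> w"
  "v \<in> V \<Longrightarrow> \<phi> (- v) = - \<phi> v"
  "v \<in> V \<Longrightarrow> \<phi> (a *\<^sub>R v) = a *\<^sub>R \<phi> v"
  "\<phi> 0 = 0"
  using phi_linear[of v w 1 1] phi_linear[of v w 1 "-1"] phi_linear[of v v "-1" 0]
    phi_linear[of v v a 0] phi_linear[of 0 0 0 0] closed(1) by simp_all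

lemma eta_hom:
  "v \<in> V \<Longrightarrow> w \<in> V \<Longrightarrow> \<eta> (v + w) = \<eta> v + \<eta> w"
  "v \<in> V \<Longrightarrow> w \<in> V \<Longrightarrow> \<eta> (v - w) = \<eta> v - \<eta> w"
  "v \<in> V \<Longrightarrow> \<eta> (- v) = - \<eta> v"
  "v \<in> V \<Longrightarrow> \<eta> (a *\<^sub>R v) = a * \<eta> v"
  "\<eta> 0 = 0"
  using eta_linear[of v w 1 1] eta_linear[of v w 1 "-1"] eta_linear[of v v "-1" 0]
    eta_linear[of v v a 0] eta_linear[of 0 0 0 0] closed(1) by simp_all

lemma g_hom_left:
  "u \<in> V \<Longrightarrow> v \<in> V \<Longrightarrow> w \<in> V \<Longrightarrow> g (u + v) w = g u w + g v w"
  "u \<in> V \<Longrightarrow> v \<in> V \<Longrightarrow> w \<in> V \<Longrightarrow> g (u - v) w = g u w - g v w"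
  "u \<in> V \<Longrightarrow> w \<in> V \<Longrightarrow> g (- u) w = - g u w"
  "u \<in> V \<Longrightarrow> w \<in> V \<Longrightarrow> g (a *\<^sub>R u) w = a * g u w"
  "w \<in> V \<Longrightarrow> g 0 w = 0"
  using g_linear[of u v w 1 1] g_linear[of u v w 1 "-1"] g_linear[of u u w "-1" 0]
    g_linear[of u u w a 0] g_linear[of 0 0 w 0 0] closed(1) by simp_all

lemma g_hom_right:
  "u \<in> V \<Longrightarrow> v \<in> V \<Longrightarrow> w \<in> V \<Longrightarrow> g w (u + v) = g w u + g w v"
  "u \<in> V \<Longrightarrow> v \<in> V \<Longrightarrow> w \<in> V \<Longrightarrow> g w (u - v) = g w u - g w v"
  "u \<in> V \<Longrightarrow> w \<in> V \<Longrightarrow> g w (- u) = - g w u"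
  "u \<in> V \<Longrightarrow> w \<in> V \<Longrightarrow> g w (a *\<^sub>R u) = a * g w u"
  "w \<in> V \<Longrightarrow> g w 0 = 0"
  by (simp_all add: g_sym[of w] closed g_hom_left)

lemmas homs = closed phi_closed xi_closed phi_hom eta_hom g_hom_left g_hom_right
  phi_xi eta_xi eta_phi phi_phi

text \<open>Put \<open>w = \<xi>\<close> in \<open>g_phi_phi\<close>: the left side vanishes because
  \<open>\<phi> \<xi> = 0\<close>.\<close>

lemma g_xi: "v \<in> V \<Longrightarrow> g v \<xi> = \<eta> v" "v \<in> V \<Longrightarrow> g \<xi> v = \<eta> v"
  using g_phi_phi[of v \<xi>] g_sym[of v \<xi>] by (simp_all add: homs)

text \<open>Replace \<open>w\<close> by \<open>\<phi> w\<close> in \<open>g_phi_phi\<close>: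
  \<open>\<phi> (\<phi> w)\<close> differs from \<open>w\<close> by a multiple of
  \<open>\<xi>\<close>, which is orthogonal to \<open>\<phi> v\<close>.\<close>

lemma g_phi_skew:
  assumes "v \<in> V" "w \<in> V"
  shows "g (\<phi> v) w = - g v (\<phi> w)"
proof -
  have "g (\<phi> v) (\<phi> (\<phi> w)) = - g v (\<phi> w)"
    using assms g_phi_phi[of v "\<phi> w"] by (simp add: homs)
  then show ?thesis using assms by (simp add: homs g_xi)
qed

text \<open>The two eigenspaces and \<open>\<xi>\<close> span \<open>V\<close>; as the eigenspaces
  have equal dimension d, this gives 2d + 1 \<ge> \<open>DIM('e)\<close> > 3 and hence d \<ge> 2.
  The isomorphism \<open>L\<close> transports the dimension count to \<open>'e\<close>.\<close>

lemma eigenvectors_exist: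
  fixes L :: "'v \<Rightarrow> 'e::euclidean_space"
  assumes L: "linear L" "inj_on L V" "L ` V = UNIV" and dim: "DIM('e) > 3"
    and eq: "dim {v \<in> V. \<eta> v = 0 \<and> \<phi> v = 1 *\<^sub>R v} = dim {v \<in> V. \<eta> v = 0 \<and> \<phi> v = - 1 *\<^sub>R v}"
    and \<epsilon>: "\<epsilon> = 1 \<or> \<epsilon> = - 1"
  shows "\<exists>e1\<in>V. \<exists>e2\<in>V. \<eta> e1 = 0 \<and> \<eta> e2 = 0 \<and> \<phi> e1 = \<epsilon> *\<^sub>R e1 \<and> \<phi> e2 = \<epsilon> *\<^sub>R e2 \<and>
    (\<forall>a b. a *\<^sub>R e1 + b *\<^sub>R e2 = 0 \<longrightarrow> a = 0 \<and> b = 0)"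
proof -
  define E where "E \<epsilon> = {v \<in> V. \<eta> v = 0 \<and> \<phi> v = \<epsilon> *\<^sub>R v}" for \<epsilon>
  have "\<exists>B. B \<subseteq> E \<epsilon> \<and> independent B \<and> E \<epsilon> \<subseteq> span B \<and> card B = dim (E \<epsilon>)" for \<epsilon>
    using basis_exists[of "E \<epsilon>"] by metis
  then obtain B where B: "B \<epsilon> \<subseteq> E \<epsilon>" "independent (B \<epsilon>)" "E \<epsilon> \<subseteq> span (B \<epsilon>)"
    "card (B \<epsilon>) = dim (E \<epsilon>)" for \<epsilon> by metis
  \<comment> \<open>The ambient type need not be finite-dimensional, and \<open>card\<close> is 0 on
    infinite sets, so finiteness is pulled back along \<open>L\<close>.\<close>
  have fin: "finite (B \<epsilon>)" for \<epsilon>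
  proof -
    have BV: "span (B \<epsilon>) \<subseteq> V"
      using B(1)[of \<epsilon>] subspace_V by (intro span_minimal) (auto simp: E_def)
    have "independent (L ` B \<epsilon>)"
      by (rule linear_independent_injective_image[OF L(1) B(2) inj_on_subset[OF L(2) BV]])
    then have "finite (L ` B \<epsilon>)" by (rule independent_imp_finite)
    moreover have "inj_on L (B \<epsilon>)" using L(2) BV span_superset by (meson inj_on_subset)
    ultimately show ?thesis by (rule finite_imageD)
  qed
  let ?S = "B 1 \<union> B (- 1) \<union> {\<xi>}"
  have "V \<subseteq> span ?S"
  proof
    fix v assume v: "v \<in> V"
    \<comment> \<open>Twice the projections of \<open>v\<close> onto the eigenspaces; half their sum
      is \<open>\<phi> (\<phi> v)\<close>, which is \<open>v\<close> without its
      \<open>\<xi>\<close>-component.\<close>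
    have "\<phi> (\<phi> v) + \<phi> v \<in> E 1" "\<phi> (\<phi> v) - \<phi> v \<in> E (- 1)"
      using v by (auto simp: E_def homs)
    then have "\<phi> (\<phi> v) + \<phi> v \<in> span (B 1)" "\<phi> (\<phi> v) - \<phi> v \<in> span (B (- 1))"
      using B(3) by blast+
    then have *: "\<phi> (\<phi> v) + \<phi> v \<in> span ?S" "\<phi> (\<phi> v) - \<phi> v \<in> span ?S"
      using span_mono[of "B 1" ?S] span_mono[of "B (- 1)" ?S] by auto
    have "\<xi> \<in> span ?S" by (simp add: span_base)
    have "(1/2) *\<^sub>R (\<phi> (\<phi> v) + \<phi> v) + (1/2) *\<^sub>R (\<phi> (\<phi> v) - \<phi> v) + \<eta> v *\<^sub>R \<xi> \<in> span ?S"
      by (intro span_add span_scale * \<open>\<xi> \<in> span ?S\<close>)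
    moreover have "(1/2) *\<^sub>R (\<phi> (\<phi> v) + \<phi> v) + (1/2) *\<^sub>R (\<phi> (\<phi> v) - \<phi> v) = \<phi> (\<phi> v)"
      by (simp add: scaleR_add_right[symmetric] scaleR_2[symmetric] del: phi_phi)
    ultimately show "v \<in> span ?S" using phi_phi[OF v] by simp
  qed
  then have "UNIV \<subseteq> span (L ` ?S)"
    using L(1,3) linear_span_image by (metis image_mono)
  then have "DIM('e) \<le> card (L ` ?S)"
    using span_card_ge_dim[of "L ` ?S" UNIV] fin by simp
  also have "\<dots> \<le> card ?S" using fin by (intro card_image_le) auto
  also have "\<dots> \<le> card (B 1) + card (B (- 1)) + 1"
    using card_Un_le[of "B 1 \<union> B (- 1)" "{\<xi>}"] card_Un_le[of "B 1" "B (- 1)"] by simp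
  finally have "2 \<le> card (B 1)" "2 \<le> card (B (- 1))"
    using dim eq B(4)[of 1] B(4)[of "-1"] by (simp_all add: E_def)
  then have "2 \<le> card (B \<epsilon>)" using \<epsilon> by auto
  then have "\<not> card (B \<epsilon>) \<le> Suc 0" by simp
  then obtain e1 e2 where e: "e1 \<in> B \<epsilon>" "e2 \<in> B \<epsilon>" "e1 \<noteq> e2"
    using card_le_Suc0_iff_eq[OF fin] by blast
  have "a = 0 \<and> b = 0" if "a *\<^sub>R e1 + b *\<^sub>R e2 = 0" for a b
  proof -
    have "independent {e1, e2}" using independent_mono[OF B(2)[of \<epsilon>]] e by simp
    then have *: "v \<in> {e1, e2} \<Longrightarrow> (if v = e1 then a else b) = 0" for v
      by (rule independentD[of _ "{e1, e2}"]) (use that e(3) in auto)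
    show ?thesis using *[of e1] *[of e2] e(3) by simp
  qed
  moreover have "e1 \<in> E \<epsilon>" "e2 \<in> E \<epsilon>" using e B(1) by blast+
  ultimately show ?thesis by (intro bexI[of _ e1] bexI[of _ e2]) (auto simp: E_def)
qed

end

text \<open>Dimension greater than 3 enters the algebra solely through two independent eigenvectors
  of \<open>\<phi>\<close> for each sign.\<close>

locale paracontact_space_large = paracontact_space +
  assumes eigenvectors: "\<epsilon> = 1 \<or> \<epsilon> = - 1 \<Longrightarrow> \<exists>e1\<in>V. \<exists>e2\<in>V. \<eta> e1 = 0 \<and> \<eta> e2 = 0 \<and>
      \<phi> e1 = \<epsilon> *\<^sub>R e1 \<and> \<phi> e2 = \<epsilon> *\<^sub>R e2 \<and> (\<forall>a b. a *\<^sub>R e1 + b *\<^sub>R e2 = 0 \<longrightarrow> a = 0 \<and> b = 0)"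
begin

text \<open>Two independent eigenvectors leave room for a nonzero solution of the single linear
  equation \<open>g e z = 0\<close>.\<close>

lemma eigenvector_orthogonal:
  assumes "\<epsilon> = 1 \<or> \<epsilon> = - 1" "z \<in> V"
  obtains e where "e \<in> V" "e \<noteq> 0" "\<eta> e = 0" "\<phi> e = \<epsilon> *\<^sub>R e" "g e z = 0"
proof -
  obtain e1 e2 where e: "e1 \<in> V" "e2 \<in> V" "\<eta> e1 = 0" "\<eta> e2 = 0"
      "\<phi> e1 = \<epsilon> *\<^sub>R e1" "\<phi> e2 = \<epsilon> *\<^sub>R e2"
    and ind: "\<And>a b. a *\<^sub>R e1 + b *\<^sub>R e2 = 0 \<Longrightarrow> a = 0 \<and> b = 0"
    using eigenvectors[OF assms(1)] by blast
  show ?thesis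
  proof (cases "g e1 z = 0")
    case True
    then show ?thesis using that[of e1] e ind[of 1 0] by auto
  next
    case False
    let ?e = "g e2 z *\<^sub>R e1 + (- g e1 z) *\<^sub>R e2"
    have "?e \<noteq> 0" using False ind[of "g e2 z" "- g e1 z"] by fastforce
    then show ?thesis using that[of ?e] e assms(2) by (simp add: homs algebra_simps)
  qed
qed

text \<open>The span of \<open>y\<close>, \<open>\<phi> y\<close> and \<open>\<xi>\<close> meets the
  eigenspace in at most a line, so one of two independent eigenvectors avoids it. The last
  conclusion serves to read off the coefficient of \<open>e\<close> in a vector identity.\<close>

lemma eigenvector_outside_span:
  assumes \<epsilon>: "\<epsilon> = 1 \<or> \<epsilon> = - 1" and y: "y \<in> V"
  obtains e where "e \<in> V" "\<eta> e = 0" "\<phi> e = \<epsilon> *\<^sub>R e"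
    "\<And>k u w z. k *\<^sub>R e = u *\<^sub>R y + w *\<^sub>R \<phi> y + z *\<^sub>R \<xi> \<Longrightarrow> k = 0"
proof -
  obtain e1 e2 where e: "e1 \<in> V" "e2 \<in> V" "\<eta> e1 = 0" "\<eta> e2 = 0"
      "\<phi> e1 = \<epsilon> *\<^sub>R e1" "\<phi> e2 = \<epsilon> *\<^sub>R e2"
    and ind: "\<And>a b. a *\<^sub>R e1 + b *\<^sub>R e2 = 0 \<Longrightarrow> a = 0 \<and> b = 0"
    using eigenvectors[OF \<epsilon>] by blast
  \<comment> \<open>Twice the projection of \<open>y\<close> onto the eigenspace; the line to be
    avoided consists of its multiples.\<close>
  define y' where "y' = \<phi> (\<phi> y) + \<epsilon> *\<^sub>R \<phi> y"
  have "\<exists>e\<in>{e1, e2}. \<forall>k. e \<noteq> k *\<^sub>R y'"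
  proof (rule ccontr)
    assume "\<not> ?thesis"
    then obtain k1 k2 where k: "e1 = k1 *\<^sub>R y'" "e2 = k2 *\<^sub>R y'" by auto
    then have "k2 *\<^sub>R e1 + (- k1) *\<^sub>R e2 = 0" by simp
    from ind[OF this] have "e1 = 0" using k by simp
    then show False using ind[of 1 0] by simp
  qed
  then obtain e where e': "e = e1 \<or> e = e2" "\<And>k. e \<noteq> k *\<^sub>R y'" by blast
  then have E: "e \<in> V" "\<eta> e = 0" "\<phi> e = \<epsilon> *\<^sub>R e" using e by auto
  have "k = 0" if eq: "k *\<^sub>R e = u *\<^sub>R y + w *\<^sub>R \<phi> y + z *\<^sub>R \<xi>" for k u w z
  proof (rule ccontr)
    assume "k \<noteq> 0"
    \<comment> \<open>The map \<open>\<lambda>v. \<phi> (\<phi> v) + \<epsilon> *\<^sub>R \<phi>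
      v\<close> doubles \<open>e\<close>, kills \<open>\<xi>\<close>, and sends \<open>y\<close> to
      \<open>y'\<close> and \<open>\<phi> y\<close> to
      \<open>\<epsilon> *\<^sub>R y'\<close>.\<close>
    have "(2 * k) *\<^sub>R e = \<phi> (\<phi> (k *\<^sub>R e)) + \<epsilon> *\<^sub>R \<phi> (k *\<^sub>R e)"
      using E \<epsilon> by (auto simp: homs scaleR_2 scaleR_scaleR[symmetric] simp del: scaleR_scaleR)
    also have "\<dots> = (u + \<epsilon> * w) *\<^sub>R y'"
      unfolding eq y'_def using y \<epsilon> by (auto simp: homs algebra_simps)
    finally have "e = ((u + \<epsilon> * w) / (2 * k)) *\<^sub>R y'"
      using \<open>k \<noteq> 0\<close>
      by (metis divide_inverse_commute mult_eq_0_iff scaleR_one scaleR_scaleR left_inverse zero_neq_numeral)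
    with e'(2) show False by blast
  qed
  with E show ?thesis by (rule that)
qed

text \<open>\<open>F\<close> plays the role of the vector fields and \<open>ev\<close> that of their evaluation at a point. The
  coefficients \<open>s\<close>, \<open>B\<close> and \<open>Q\<close> may depend on the fields and not just on their values.\<close>

lemma curvature_rigidity:
  fixes F :: "'f set" and ev :: "'f \<Rightarrow> 'a" and \<Phi> :: "'f \<Rightarrow> 'f" and \<Xi> :: 'f
    and R :: "'f \<Rightarrow> 'f \<Rightarrow> 'f \<Rightarrow> 'a" and s B :: "'f \<Rightarrow> 'f \<Rightarrow> real" and Q :: "'f \<Rightarrow> 'a"
  assumes ev: "\<And>X. X \<in> F \<Longrightarrow> ev X \<in> V"
    and onto: "\<And>v. v \<in> V \<Longrightarrow> \<exists>X\<in>F. ev X = v"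
    and \<Phi>: "\<And>X. X \<in> F \<Longrightarrow> \<Phi> X \<in> F" "\<And>X. X \<in> F \<Longrightarrow> ev (\<Phi> X) = \<phi> (ev X)"
    and \<Xi>: "\<Xi> \<in> F" "ev \<Xi> = \<xi>"
    and Q: "\<And>X. X \<in> F \<Longrightarrow> Q X \<in> V"
    and R_xi: "\<And>X Y. X \<in> F \<Longrightarrow> Y \<in> F \<Longrightarrow> R X Y \<Xi> = \<eta> (ev X) *\<^sub>R ev Y - \<eta> (ev Y) *\<^sub>R ev X"
    and R_phi: "\<And>X Y Z. X \<in> F \<Longrightarrow> Y \<in> F \<Longrightarrow> Z \<in> F \<Longrightarrow> R X Y (\<Phi> Z) - \<phi> (R X Y Z) =
       g (ev Y) (ev Z) *\<^sub>R \<phi> (ev X) - g (\<phi> (ev X)) (ev Z) *\<^sub>R ev Y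
       - g (ev X) (ev Z) *\<^sub>R \<phi> (ev Y) + g (\<phi> (ev Y)) (ev Z) *\<^sub>R ev X"
    and R_decomp: "\<And>X Y Z. X \<in> F \<Longrightarrow> Y \<in> F \<Longrightarrow> Z \<in> F \<Longrightarrow> R X Y Z =
       - s X Y *\<^sub>R ev Z + B Y Z *\<^sub>R ev X - B X Z *\<^sub>R ev Y
       + g (ev Y) (ev Z) *\<^sub>R Q X - g (ev X) (ev Z) *\<^sub>R Q Y"
    and XYZ: "X \<in> F" "Y \<in> F" "Z \<in> F"
  shows "R X Y Z = g (ev X) (ev Z) *\<^sub>R ev Y - g (ev Y) (ev Z) *\<^sub>R ev X"
proof -
  \<comment> \<open>\<open>l\<close> is the scalar \<lambda> that cancels at the end;
    \<open>b\<close> and \<open>q\<close> collect what is still unknown about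
    \<open>Q\<close>.\<close>
  define l where "l = B \<Xi> \<Xi>"
  define b where "b X = B X \<Xi> + s X \<Xi>" for X
  define q where "q = Q \<Xi>"
  have q: "q \<in> V" using Q \<Xi> by (simp add: q_def)
  note [simp] = ev \<Phi> \<Xi> Q q homs g_xi
  \<comment> \<open>Put \<open>\<Xi>\<close> in the last two places of the decomposition, compare
    with \<open>R_xi\<close> and solve for \<open>Q X\<close>.\<close>
  have Q_form: "Q X = - (1 + l) *\<^sub>R ev X + \<eta> (ev X) *\<^sub>R (\<xi> + q) + b X *\<^sub>R \<xi>" if X: "X \<in> F" for X
    using R_decomp[OF X \<Xi>(1) \<Xi>(1)] R_xi[OF X \<Xi>(1)] X
    by (simp add: l_def[symmetric] q_def[symmetric] b_def algebra_simps)
  \<comment> \<open>Insert an eigenvector \<open>E\<close> in general position to \<open>Y\<close>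
    into \<open>R_phi\<close>. The \<open>s\<close>-terms cancel since \<phi> commutes with scalars,
    and as \<open>Q Y\<close> lies in the span of \<open>Y\<close> and \<open>\<xi>\<close>, the
    coefficient of \<open>e\<close> must vanish. The two signs of \<epsilon> then force both sides
    of \<open>eps\<close> to be 0.\<close>
  have A: "B Y Z = l * g (ev Y) (ev Z)"
    if Y: "Y \<in> F" and Z: "Z \<in> F" and QY: "Q Y = m *\<^sub>R ev Y + n *\<^sub>R \<xi>" for Y Z m n
  proof -
    have eps: "B Y (\<Phi> Z) - l * g (ev Y) (\<phi> (ev Z)) = \<epsilon> * (B Y Z - l * g (ev Y) (ev Z))"
      if \<epsilon>: "\<epsilon> = 1 \<or> \<epsilon> = - 1" for \<epsilon>
    proof -
      obtain e where e: "e \<in> V" "\<eta> e = 0" "\<phi> e = \<epsilon> *\<^sub>R e"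
        "\<And>k u w z. k *\<^sub>R e = u *\<^sub>R ev Y + w *\<^sub>R \<phi> (ev Y) + z *\<^sub>R \<xi> \<Longrightarrow> k = 0"
        using eigenvector_outside_span[OF \<epsilon> ev[OF Y]] by blast
      obtain E where E: "E \<in> F" "ev E = e" using onto e by blast
      have "(B Y (\<Phi> Z) - l * g (ev Y) (\<phi> (ev Z)) - \<epsilon> * (B Y Z - l * g (ev Y) (ev Z))) *\<^sub>R e
        = (B E (\<Phi> Z) + g e (\<phi> (ev Z)) * m - g (\<phi> e) (ev Z)) *\<^sub>R ev Y
          + (- B E Z - g e (ev Z) * m - g e (ev Z)) *\<^sub>R \<phi> (ev Y)
          + (g e (\<phi> (ev Z)) * n - g (ev Y) (\<phi> (ev Z)) * b E) *\<^sub>R \<xi>"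
        using R_phi[OF E(1) Y Z] Y Z E e(1-3)
        by (simp add: R_decomp Q_form[OF E(1)] QY g_phi_skew algebra_simps)
      from e(4)[OF this] show ?thesis by simp
    qed
    from eps[of 1] eps[of "-1"] show ?thesis by simp
  qed
  \<comment> \<open>On the kernel of \<eta>, \<open>Q_form\<close> already has the shape that
    \<open>A\<close> requires.\<close>
  have A0: "B Y Z = l * g (ev Y) (ev Z)" if "Y \<in> F" "Z \<in> F" "\<eta> (ev Y) = 0" for Y Z
    using A[OF that(1,2), of "- (1 + l)" "b Y"] Q_form[OF that(1)] that(3) by simp
  \<comment> \<open>The \<open>\<xi>\<close>-component of \<open>R X Y (\<Phi> E)\<close> is
    computed from the decomposition and again from \<open>R_phi\<close>, for an eigenvector
    \<open>E\<close> orthogonal to \<open>X\<close>; comparing the two gives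
    \<open>b X\<close>.\<close>
  have b: "b X = - \<eta> (ev X) * (1 + \<eta> q)" if X: "X \<in> F" for X
  proof -
    obtain e where e: "e \<in> V" "e \<noteq> 0" "\<eta> e = 0" "\<phi> e = 1 *\<^sub>R e" "g e (ev X) = 0"
      using eigenvector_orthogonal[of 1 "ev X"] X by auto
    obtain E where E: "E \<in> F" "ev E = e" using onto e by blast
    obtain w where w: "w \<in> V" "g e w \<noteq> 0" using g_nondegenerate[OF e(1)] e(2) by blast
    \<comment> \<open>The part of \<open>w\<close> in the kernel of \<eta>: its product with
      \<open>e\<close> is unchanged, and \<open>A0\<close> applies to it.\<close>
    obtain Y where Y: "Y \<in> F" "ev Y = \<phi> (\<phi> w)" using onto w by (metis phi_closed)
    have y: "\<eta> (ev Y) = 0" "g (ev Y) e = g e w" using Y(2) w e by (simp_all add: g_sym[of _ e])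
    have x: "g (ev X) e = 0" "g (\<phi> (ev X)) e = 0"
      using e X g_phi_skew[of "ev X" e] by (simp_all add: g_sym[of _ e])
    have "\<eta> (R X Y (\<Phi> E)) = g e w * (\<eta> (ev X) * \<eta> q + b X)"
      using X Y(1) E e x y
      by (simp add: R_decomp A0 Q_form[OF X] algebra_simps)
    moreover have "\<eta> (R X Y (\<Phi> E)) = - g e w * \<eta> (ev X)"
    proof -
      have "R X Y E \<in> V" using X Y(1) E e by (simp add: R_decomp)
      moreover have "R X Y (\<Phi> E) = \<phi> (R X Y E) + (g (ev Y) e *\<^sub>R \<phi> (ev X) - g (\<phi> (ev X)) e *\<^sub>R ev Y
          - g (ev X) e *\<^sub>R \<phi> (ev Y) + g (\<phi> (ev Y)) e *\<^sub>R ev X)"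
        using R_phi[OF X Y(1) E(1)] E(2) by (simp add: algebra_simps)
      ultimately show ?thesis
        using X Y(1) e x y g_phi_skew[of "ev Y" e] by simp
    qed
    ultimately have "g e w * (\<eta> (ev X) * \<eta> q + b X) = g e w * - \<eta> (ev X)" by simp
    then have "\<eta> (ev X) * \<eta> q + b X = - \<eta> (ev X)" using w(2) mult_left_cancel by blast
    then show ?thesis by (simp add: algebra_simps)
  qed
  \<comment> \<open>The part of \<open>q\<close> in the kernel of \<eta>, the last obstruction to
    \<open>Q\<close> being a multiple of the identity.\<close>
  define r where "r = q - \<eta> q *\<^sub>R \<xi>"
  have r: "r \<in> V" by (simp add: r_def)
  have Q_form': "Q X = - (1 + l) *\<^sub>R ev X + \<eta> (ev X) *\<^sub>R r" if X: "X \<in> F" for X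
    using Q_form[OF X] by (simp add: b[OF X] r_def algebra_simps)
  \<comment> \<open>At \<open>\<Xi>\<close> the fact \<open>A\<close> is not yet available, because
    \<open>Q \<Xi>\<close> involves \<open>r\<close>. Inserting \<open>E\<close> and
    \<open>\<Xi>\<close> into \<open>R_phi\<close> relates the defect of \<open>B \<Xi>\<close> to
    \<open>r\<close>.\<close>
  have C: "(B \<Xi> (\<Phi> Z) - \<epsilon> * (B \<Xi> Z - l * \<eta> (ev Z))) *\<^sub>R ev E = - g (ev E) (ev Z) *\<^sub>R (\<epsilon> *\<^sub>R r + \<phi> r)"
    if Z: "Z \<in> F" and E: "E \<in> F" "\<eta> (ev E) = 0" "\<phi> (ev E) = \<epsilon> *\<^sub>R ev E" for E Z \<epsilon>
  proof -
    have "g (ev E) (\<phi> (ev Z)) = - \<epsilon> * g (ev E) (ev Z)"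
      using g_phi_skew[of "ev E" "ev Z"] E Z by simp
    then show ?thesis
      using R_phi[OF E(1) \<Xi>(1) Z] Z E r by (simp add: R_decomp Q_form' A0 algebra_simps)
  qed
  \<comment> \<open>For \<open>E\<close> orthogonal to \<open>Z\<close> the right side of
    \<open>C\<close> vanishes; the two signs give both claims.\<close>
  have C1: "B \<Xi> Z = l * \<eta> (ev Z) \<and> B \<Xi> (\<Phi> Z) = 0" if Z: "Z \<in> F" for Z
  proof -
    have "B \<Xi> (\<Phi> Z) = \<epsilon> * (B \<Xi> Z - l * \<eta> (ev Z))" if \<epsilon>: "\<epsilon> = 1 \<or> \<epsilon> = - 1" for \<epsilon>
    proof -
      obtain e where e: "e \<in> V" "e \<noteq> 0" "\<eta> e = 0" "\<phi> e = \<epsilon> *\<^sub>R e" "g e (ev Z) = 0"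
        using eigenvector_orthogonal[OF \<epsilon>, of "ev Z"] Z by auto
      obtain E where E: "E \<in> F" "ev E = e" using onto e by blast
      show ?thesis using C[OF Z E(1), of \<epsilon>] E e by simp
    qed
    from this[of 1] this[of "-1"] show ?thesis by simp
  qed
  \<comment> \<open>By \<open>C1\<close> the left side of \<open>C\<close> is now 0; a
    \<open>W\<close> not orthogonal to \<open>E\<close> leaves this equation for \<open>r\<close>,
    and the two signs together give \<open>r = 0\<close>.\<close>
  have "\<epsilon> *\<^sub>R r + \<phi> r = 0" if \<epsilon>: "\<epsilon> = 1 \<or> \<epsilon> = - 1" for \<epsilon>
  proof -
    obtain e where e: "e \<in> V" "e \<noteq> 0" "\<eta> e = 0" "\<phi> e = \<epsilon> *\<^sub>R e"
      using eigenvector_orthogonal[OF \<epsilon> closed(1)] by blast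
    obtain E where E: "E \<in> F" "ev E = e" using onto e by blast
    obtain w where w: "w \<in> V" "g e w \<noteq> 0" using g_nondegenerate[OF e(1)] e(2) by blast
    obtain W where W: "W \<in> F" "ev W = w" using onto w by blast
    show ?thesis using C[OF W(1) E(1), of \<epsilon>] E W e w C1[OF W(1)] by simp
  qed
  from this[of 1] this[of "-1"] have "r + \<phi> r = 0" "\<phi> r = r" by simp_all
  then have "2 *\<^sub>R r = 0" by (simp add: scaleR_2)
  then have "r = 0" by simp
  then have Q_final: "Q X = - (1 + l) *\<^sub>R ev X" if "X \<in> F" for X
    using Q_form'[OF that] by simp
  \<comment> \<open>With \<open>r = 0\<close> each \<open>Q Y\<close> is a multiple of
    \<open>Y\<close>, so \<open>A\<close> holds for all fields; in \<open>RR\<close> the scalar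
    \<open>l\<close> cancels.\<close>
  have B: "B Y Z = l * g (ev Y) (ev Z)" if "Y \<in> F" "Z \<in> F" for Y Z
    using A[OF that, of "- (1 + l)" 0] Q_final that by simp
  have RR: "R X Y Z = - s X Y *\<^sub>R ev Z + g (ev X) (ev Z) *\<^sub>R ev Y - g (ev Y) (ev Z) *\<^sub>R ev X"
    if "Z \<in> F" for Z
    using XYZ(1,2) that by (simp add: R_decomp B Q_final algebra_simps)
  \<comment> \<open>Comparing \<open>RR\<close> at \<open>\<Xi>\<close> with \<open>R_xi\<close>
    leaves only the \<open>s\<close>-term.\<close>
  have "s X Y *\<^sub>R \<xi> = 0"
    using RR[OF \<Xi>(1)] R_xi[OF XYZ(1,2)] XYZ by simp
  moreover have "\<xi> \<noteq> 0" using eta_xi eta_hom(5) by (metis zero_neq_one)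
  ultimately have "s X Y = 0" by simp
  then show ?thesis using RR[OF XYZ(3)] by simp
qed

end

section \<open>Quasi-para-Sasakian manifolds\<close>

context smooth_mfd
begin

section \<open>Affine connections on an open set\<close>

lemma connection_closed:
  "affine_connection A U D \<Longrightarrow> X \<in> vector_fields A U \<Longrightarrow> Y \<in> vector_fields A U \<Longrightarrow>
    D X Y \<in> vector_fields A U"
  by (simp add: affine_connection_def)

lemma connection_add:
  "affine_connection A U D \<Longrightarrow> X \<in> vector_fields A U \<Longrightarrow> Y \<in> vector_fields A U \<Longrightarrow>
    Z \<in> vector_fields A U \<Longrightarrow> p \<in> U \<Longrightarrow> D X (\<lambda>q. Y q + Z q) p = D X Y p + D X Z p"
  by (simp add: affine_connection_def)

lemma connection_scaleR:
  "affine_connection A U D \<Longrightarrow> smooth_function A U f \<Longrightarrow> X \<in> vector_fields A U \<Longrightarrow>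
    Y \<in> vector_fields A U \<Longrightarrow> p \<in> U \<Longrightarrow>
    D X (\<lambda>q. f q *\<^sub>R Y q) p = field_deriv A X f p *\<^sub>R Y p + f p *\<^sub>R D X Y p"
  by (simp add: affine_connection_def)

text \<open>A field vanishing on \<open>U\<close> equals its multiple by the indicator of the complement of \<open>U\<close>, which is
  a smooth function on \<open>U\<close>. Hence a connection ignores the values of its arguments outside \<open>U\<close>.\<close>

lemma connection_zero:
  assumes U: "openin T U" and D: "affine_connection A U D" and X: "X \<in> vector_fields A U"
    and Y: "Y \<in> vector_fields A U" "\<And>q. q \<in> U \<Longrightarrow> Y q = 0" and p: "p \<in> U"
  shows "D X Y p = 0"
proof -
  define h :: "'m \<Rightarrow> real" where "h q = (if q \<in> U then 0 else 1)" for q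
  have h: "smooth_function A U h"
    by (rule smooth_function_cong[OF U _ smooth_function_const[of _ 0]]) (simp add: h_def)
  have "Y = (\<lambda>q. h q *\<^sub>R Y q)" using Y(2) by (auto simp: h_def)
  then have "D X Y p = D X (\<lambda>q. h q *\<^sub>R Y q) p" by simp
  also have "\<dots> = 0"
    using connection_scaleR[OF D h X Y(1) p] p Y(2) by (simp add: h_def)
  finally show ?thesis .
qed

lemma connection_diff:
  assumes U: "openin T U" and D: "affine_connection A U D" and X: "X \<in> vector_fields A U"
    and Y: "Y \<in> vector_fields A U" and Z: "Z \<in> vector_fields A U" and p: "p \<in> U"
  shows "D X (\<lambda>q. Y q - Z q) p = D X Y p - D X Z p"
  using connection_add[OF D X vector_fields_diff[OF U Y Z] Z p] by simp

lemma connection_cong: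
  assumes U: "openin T U" and D: "affine_connection A U D" and X: "X \<in> vector_fields A U"
    and Y: "Y \<in> vector_fields A U" "\<And>q. q \<in> U \<Longrightarrow> Y q = Z q" and p: "p \<in> U"
  shows "D X Y p = D X Z p"
proof -
  have Z: "Z \<in> vector_fields A U" by (rule vector_fields_cong[OF U Y(2) Y(1)])
  have "D X (\<lambda>q. Y q - Z q) p = 0"
    by (rule connection_zero[OF U D X vector_fields_diff[OF U Y(1) Z] _ p]) (simp add: Y(2))
  then show ?thesis using connection_diff[OF U D X Y(1) Z p] by simp
qed

text \<open>Torsion-freeness writes the bracket as a difference of covariant derivatives, whose
  smoothness is part of being a connection.\<close>

lemma lie_bracket_in:
  assumes U: "openin T U" and D: "levi_civita_connection A U g D"
    and X: "X \<in> vector_fields A U" and Y: "Y \<in> vector_fields A U"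
  shows "lie_bracket A X Y \<in> vector_fields A U"
proof (rule vector_fields_cong[OF U])
  have aff: "affine_connection A U D" using D by (simp add: levi_civita_connection_def)
  show "(\<lambda>q. D X Y q - D Y X q) \<in> vector_fields A U"
    by (rule vector_fields_diff[OF U connection_closed[OF aff X Y] connection_closed[OF aff Y X]])
  show "D X Y q - D Y X q = lie_bracket A X Y q" if "q \<in> U" for q
    using D X Y that by (simp add: levi_civita_connection_def)
qed

end

locale quasi_para_Sasakian_mfd = smooth_mfd T A
  for T :: "'m topology" and A :: "('m, 'e::euclidean_space) chart set" +
  fixes \<phi> :: "'m \<Rightarrow> ('m, 'e) tvec \<Rightarrow> ('m, 'e) tvec" and \<eta> :: "'m \<Rightarrow> ('m, 'e) tvec \<Rightarrow> real"
    and \<xi> :: "'m \<Rightarrow> ('m, 'e) tvec"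
    and g :: "'m \<Rightarrow> ('m, 'e) tvec \<Rightarrow> ('m, 'e) tvec \<Rightarrow> real" and D :: "('m, 'e) connection"
  assumes quasi_para_Sasakian_mfd: "quasi_para_Sasakian T A \<phi> \<eta> \<xi> g D"
begin

abbreviation "M \<equiv> topspace T"
abbreviation "VF \<equiv> vector_fields A M"

lemma apcm: "almost_paracontact_metric T A \<phi> \<eta> \<xi> g"
  using quasi_para_Sasakian_mfd by (simp add: quasi_para_Sasakian_def)

lemma levi_civita: "levi_civita_connection A M g D"
  using quasi_para_Sasakian_mfd by (simp add: quasi_para_Sasakian_def)

lemma aff: "affine_connection A M D"
  using levi_civita by (simp add: levi_civita_connection_def)

lemma torsion_free:
  "X \<in> VF \<Longrightarrow> Y \<in> VF \<Longrightarrow> p \<in> M \<Longrightarrow> lie_bracket A X Y p = D X Y p - D Y X p"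
  using levi_civita by (simp add: levi_civita_connection_def)

lemma metric_compat:
  "X \<in> VF \<Longrightarrow> Y \<in> VF \<Longrightarrow> Z \<in> VF \<Longrightarrow> p \<in> M \<Longrightarrow>
    field_deriv A X (\<lambda>q. g q (Y q) (Z q)) p = g p (D X Y p) (Z p) + g p (Y p) (D X Z p)"
  using levi_civita by (simp add: levi_civita_connection_def)

lemma D_phi:
  assumes "X \<in> VF" "Y \<in> VF" "p \<in> M"
  shows "D X (\<lambda>q. \<phi> q (Y q)) p
    = \<phi> p (D X Y p) + g p (X p) (Y p) *\<^sub>R \<xi> p - \<eta> p (Y p) *\<^sub>R X p"
proof -
  have "D X (\<lambda>q. \<phi> q (Y q)) p - \<phi> p (D X Y p) = g p (X p) (Y p) *\<^sub>R \<xi> p - \<eta> p (Y p) *\<^sub>R X p"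
    using quasi_para_Sasakian_mfd assms unfolding quasi_para_Sasakian_def by blast
  then show ?thesis by (simp add: diff_eq_eq algebra_simps)
qed

lemma xi_in: "\<xi> \<in> VF"
  using apcm by (simp add: almost_paracontact_metric_def)

lemma phi_in: "X \<in> VF \<Longrightarrow> (\<lambda>q. \<phi> q (X q)) \<in> VF"
  using apcm by (simp add: almost_paracontact_metric_def endomorphism_field_def)

lemma eta_smooth: "X \<in> VF \<Longrightarrow> smooth_function A M (\<lambda>q. \<eta> q (X q))"
  using apcm by (simp add: almost_paracontact_metric_def one_form_def)

lemma g_smooth: "X \<in> VF \<Longrightarrow> Y \<in> VF \<Longrightarrow> smooth_function A M (\<lambda>q. g q (X q) (Y q))"
  using apcm by (simp add: almost_paracontact_metric_def pseudo_riemannian_metric_def)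

lemma pointwise:
  assumes "p \<in> M"
  shows "paracontact_space (tangent_space A p) (\<phi> p) (\<eta> p) (\<xi> p) (g p)"
proof -
  have *: "endomorphism_field A M \<phi>" "one_form A M \<eta>" "pseudo_riemannian_metric A M g"
    "\<phi> p (\<xi> p) = 0 \<and> \<eta> p (\<xi> p) = 1 \<and>
        (\<forall>v\<in>tangent_space A p. \<eta> p (\<phi> p v) = 0 \<and> \<phi> p (\<phi> p v) = v - \<eta> p v *\<^sub>R \<xi> p) \<and>
        (\<forall>v\<in>tangent_space A p. \<forall>w\<in>tangent_space A p.
           g p (\<phi> p v) (\<phi> p w) = - g p v w + \<eta> p v * \<eta> p w)"
    using apcm assms by (simp_all add: almost_paracontact_metric_def)
  show ?thesis
    by standard
       (use * assms subspace_tangent_space vector_fieldsD(1)[OF xi_in] in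
         \<open>simp_all add: endomorphism_field_def one_form_def pseudo_riemannian_metric_def\<close>)
qed

text \<open>For a chart \<open>c\<close> around \<open>p\<close>, taking components in
  \<open>c\<close> is the isomorphism that \<open>eigenvectors_exist\<close> asks for.\<close>

lemma pointwise_large:
  assumes "p \<in> M" and dim: "DIM('e) > 3"
  shows "paracontact_space_large (tangent_space A p) (\<phi> p) (\<eta> p) (\<xi> p) (g p)"
proof -
  interpret paracontact_space "tangent_space A p" "\<phi> p" "\<eta> p" "\<xi> p" "g p"
    by (rule pointwise[OF assms(1)])
  obtain c where c: "c \<in> A" "p \<in> fst c" using chart_exists[OF assms(1)] by blast
  have "linear (\<lambda>v :: ('m, 'e) tvec. comp v c)" by (rule linearI) simp_all
  moreover have "inj_on (\<lambda>v. comp v c) (tangent_space A p)"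
    using c by (auto intro: inj_onI tangent_space_eqI)
  moreover have "(\<lambda>v. comp v c) ` tangent_space A p = UNIV"
  proof -
    have "w \<in> (\<lambda>v. comp v c) ` tangent_space A p" for w
      using c by (intro image_eqI[of _ _ "tangent_of c p w"]) (simp_all add: comp_tangent_of Jac_self tangent_of_in)
    then show ?thesis by blast
  qed
  moreover have "dim {v \<in> tangent_space A p. \<eta> p v = 0 \<and> \<phi> p v = 1 *\<^sub>R v}
      = dim {v \<in> tangent_space A p. \<eta> p v = 0 \<and> \<phi> p v = - 1 *\<^sub>R v}"
    using apcm assms(1) by (simp add: almost_paracontact_metric_def almost_paracomplex_on_def conj_assoc)
  ultimately show ?thesis
    by unfold_locales (rule eigenvectors_exist[OF _ _ _ dim], assumption+)
qed

section \<open>Covariant derivatives and curvature identities for \<xi> and \<phi>\<close>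

lemma D_in: "X \<in> VF \<Longrightarrow> Y \<in> VF \<Longrightarrow> D X Y \<in> VF"
  by (rule connection_closed[OF aff])

lemma bracket_in: "X \<in> VF \<Longrightarrow> Y \<in> VF \<Longrightarrow> lie_bracket A X Y \<in> VF"
  by (rule lie_bracket_in[OF openin_topspace levi_civita])

lemma VF_at: "X \<in> VF \<Longrightarrow> p \<in> M \<Longrightarrow> X p \<in> tangent_space A p"
  by (rule vector_fieldsD(1))

text \<open>Since \<open>\<phi> \<xi> = 0\<close>, the structure equation at \<open>\<xi>\<close>
  gives \<open>\<phi> (D X \<xi>) = \<phi> (\<phi> X)\<close>, which fixes \<open>D X \<xi>\<close>
  up to a multiple of \<open>\<xi>\<close>. Differentiating \<open>g \<xi> \<xi> = 1\<close> shows
  that this multiple is 0.\<close>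

lemma D_xi:
  assumes X: "X \<in> VF" and p: "p \<in> M"
  shows "D X \<xi> p = \<phi> p (X p)"
proof -
  interpret paracontact_space "tangent_space A p" "\<phi> p" "\<eta> p" "\<xi> p" "g p"
    by (rule pointwise[OF p])
  let ?v = "D X \<xi> p"
  note V [simp] = VF_at[OF X p] VF_at[OF D_in[OF X xi_in] p]
  have "D X (\<lambda>q. \<phi> q (\<xi> q)) p = 0"
    using paracontact_space.phi_xi[OF pointwise]
    by (intro connection_zero[OF openin_topspace aff X phi_in[OF xi_in] _ p])
  then have "\<phi> p ?v = \<phi> p (\<phi> p (X p))"
    using D_phi[OF X xi_in p] by (simp add: homs g_xi eq_diff_eq)
  then have "\<phi> p (\<phi> p ?v) = \<phi> p (\<phi> p (\<phi> p (X p)))" by simp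
  then have v: "?v = \<phi> p (X p) + \<eta> p ?v *\<^sub>R \<xi> p"
    by (simp add: homs diff_eq_eq)
  have "field_deriv A X (\<lambda>q. g q (\<xi> q) (\<xi> q)) p = field_deriv A X (\<lambda>q. 1) p"
    using paracontact_space.g_xi(1)[OF pointwise] paracontact_space.eta_xi[OF pointwise]
      paracontact_space.xi_closed[OF pointwise]
    by (intro field_deriv_cong[OF openin_topspace g_smooth[OF xi_in xi_in] p]) simp
  then have "\<eta> p ?v = 0"
    using metric_compat[OF X xi_in xi_in p] by (simp add: field_deriv_const g_xi)
  then show ?thesis using v by simp
qed

text \<open>By \<open>D_xi\<close> the second derivatives of \<open>\<xi>\<close> are first
  derivatives of \<phi>Y and \<phi>X, given by \<open>D_phi\<close>. On antisymmetrising, the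
  \<phi>-terms cancel against the bracket and the \<open>\<xi>\<close>-terms by symmetry of
  \<open>g\<close>.\<close>

lemma curvature_xi:
  assumes X: "X \<in> VF" and Y: "Y \<in> VF" and p: "p \<in> M"
  shows "curvature A D X Y \<xi> p = \<eta> p (X p) *\<^sub>R Y p - \<eta> p (Y p) *\<^sub>R X p"
proof -
  interpret paracontact_space "tangent_space A p" "\<phi> p" "\<eta> p" "\<xi> p" "g p"
    by (rule pointwise[OF p])
  have DD: "D X (D Y \<xi>) p = \<phi> p (D X Y p) + g p (X p) (Y p) *\<^sub>R \<xi> p - \<eta> p (Y p) *\<^sub>R X p"
    if "X \<in> VF" "Y \<in> VF" for X Y
    using connection_cong[OF openin_topspace aff that(1) D_in[OF that(2) xi_in] D_xi[OF that(2)] p]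
      D_phi[OF that p] by simp
  show ?thesis
    using VF_at[OF X p] VF_at[OF Y p] VF_at[OF D_in[OF X Y] p] VF_at[OF D_in[OF Y X] p]
    by (simp add: curvature_def DD X Y D_xi[OF bracket_in[OF X Y] p] torsion_free p homs g_sym)
qed

lemma deriv_eta:
  assumes X: "X \<in> VF" and Z: "Z \<in> VF" and p: "p \<in> M"
  shows "field_deriv A X (\<lambda>q. \<eta> q (Z q)) p = \<eta> p (D X Z p) + g p (Z p) (\<phi> p (X p))"
proof -
  interpret paracontact_space "tangent_space A p" "\<phi> p" "\<eta> p" "\<xi> p" "g p"
    by (rule pointwise[OF p])
  have "field_deriv A X (\<lambda>q. \<eta> q (Z q)) p = field_deriv A X (\<lambda>q. g q (Z q) (\<xi> q)) p"
    using paracontact_space.g_xi(1)[OF pointwise VF_at[OF Z]]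
    by (intro field_deriv_cong[OF openin_topspace eta_smooth[OF Z] p]) simp
  then show ?thesis
    using metric_compat[OF X Z xi_in p] VF_at[OF D_in[OF X Z] p] by (simp add: D_xi X p g_xi)
qed

lemma D_D_phi:
  assumes X: "X \<in> VF" and Y: "Y \<in> VF" and Z: "Z \<in> VF" and p: "p \<in> M"
  shows "D X (D Y (\<lambda>q. \<phi> q (Z q))) p
    = \<phi> p (D X (D Y Z) p) + g p (X p) (D Y Z p) *\<^sub>R \<xi> p - \<eta> p (D Y Z p) *\<^sub>R X p
      + (g p (D X Y p) (Z p) + g p (Y p) (D X Z p)) *\<^sub>R \<xi> p + g p (Y p) (Z p) *\<^sub>R \<phi> p (X p)
      - (\<eta> p (D X Z p) + g p (Z p) (\<phi> p (X p))) *\<^sub>R Y p - \<eta> p (Z p) *\<^sub>R D X Y p"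
proof -
  note o = openin_topspace[of T]
  note I = phi_in[OF D_in[OF Y Z]] vector_fields_scaleR[OF o g_smooth[OF Y Z] xi_in]
    vector_fields_scaleR[OF o eta_smooth[OF Z] Y]
  have "D X (D Y (\<lambda>q. \<phi> q (Z q))) p
    = D X (\<lambda>q. \<phi> q (D Y Z q) + g q (Y q) (Z q) *\<^sub>R \<xi> q - \<eta> q (Z q) *\<^sub>R Y q) p"
    by (rule connection_cong[OF o aff X D_in[OF Y phi_in[OF Z]] D_phi[OF Y Z] p])
  also have "\<dots> = D X (\<lambda>q. \<phi> q (D Y Z q)) p + D X (\<lambda>q. g q (Y q) (Z q) *\<^sub>R \<xi> q) p
      - D X (\<lambda>q. \<eta> q (Z q) *\<^sub>R Y q) p"
    by (simp add: connection_diff[OF o aff X vector_fields_add[OF o I(1,2)] I(3) p]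
        connection_add[OF aff X I(1,2) p])
  also have "D X (\<lambda>q. \<phi> q (D Y Z q)) p
      = \<phi> p (D X (D Y Z) p) + g p (X p) (D Y Z p) *\<^sub>R \<xi> p - \<eta> p (D Y Z p) *\<^sub>R X p"
    by (rule D_phi[OF X D_in[OF Y Z] p])
  also have "D X (\<lambda>q. g q (Y q) (Z q) *\<^sub>R \<xi> q) p
      = (g p (D X Y p) (Z p) + g p (Y p) (D X Z p)) *\<^sub>R \<xi> p + g p (Y p) (Z p) *\<^sub>R \<phi> p (X p)"
    using connection_scaleR[OF aff g_smooth[OF Y Z] X xi_in p]
    by (simp add: metric_compat[OF X Y Z p] D_xi[OF X p])
  also have "D X (\<lambda>q. \<eta> q (Z q) *\<^sub>R Y q) p
      = (\<eta> p (D X Z p) + g p (Z p) (\<phi> p (X p))) *\<^sub>R Y p + \<eta> p (Z p) *\<^sub>R D X Y p"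
    using connection_scaleR[OF aff eta_smooth[OF Z] X Y p] by (simp add: deriv_eta[OF X Z p])
  finally show ?thesis by (simp add: algebra_simps)
qed

text \<open>The Ricci identity for \<phi>: antisymmetrise \<open>D_D_phi\<close> and subtract the
  bracket term. Outside \<phi>(R(X,Y)Z), the derivatives of \<open>Z\<close> cancel by symmetry, and
  those of \<open>X\<close> and \<open>Y\<close> cancel against the bracket.\<close>

lemma curvature_phi:
  assumes X: "X \<in> VF" and Y: "Y \<in> VF" and Z: "Z \<in> VF" and p: "p \<in> M"
  shows "curvature A D X Y (\<lambda>q. \<phi> q (Z q)) p - \<phi> p (curvature A D X Y Z p) =
    g p (Y p) (Z p) *\<^sub>R \<phi> p (X p) - g p (\<phi> p (X p)) (Z p) *\<^sub>R Y p
    - g p (X p) (Z p) *\<^sub>R \<phi> p (Y p) + g p (\<phi> p (Y p)) (Z p) *\<^sub>R X p"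
proof -
  interpret paracontact_space "tangent_space A p" "\<phi> p" "\<eta> p" "\<xi> p" "g p"
    by (rule pointwise[OF p])
  note B = bracket_in[OF X Y]
  have V [simp]: "W p \<in> tangent_space A p" if "W \<in> VF" for W using VF_at[OF that p] .
  note [simp] = X Y Z B D_in
  have "g p (Z p) (\<phi> p (X p)) = g p (\<phi> p (X p)) (Z p)" "g p (Z p) (\<phi> p (Y p)) = g p (\<phi> p (Y p)) (Z p)"
    by (simp_all add: g_sym homs)
  then show ?thesis
    unfolding curvature_def D_D_phi[OF X Y Z p] D_D_phi[OF Y X Z p] D_phi[OF B Z p]
    by (simp add: homs torsion_free p algebra_simps)
qed

end

section \<open>Conformal change of the metric\<close>

locale conformal_quasi_para_Sasakian = quasi_para_Sasakian_mfd T A \<phi> \<eta> \<xi> g D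
  for T :: "'m topology" and A :: "('m, 'e::euclidean_space) chart set" and \<phi> \<eta> \<xi> g D +
  fixes U :: "'m set" and f :: "'m \<Rightarrow> real" and D' :: "('m, 'e) connection"
  assumes U: "openin T U" and f: "smooth_function A U f"
    and levi_civita': "levi_civita_connection A U (\<lambda>q v w. exp (2 * f q) * g q v w) D'"
begin

lemma UM: "p \<in> U \<Longrightarrow> p \<in> M"
  using openin_subset[OF U] by blast

lemma VF_U: "X \<in> VF \<Longrightarrow> X \<in> vector_fields A U"
  by (rule vector_fields_subset[OF _ openin_subset[OF U]])

lemma aff': "affine_connection A U D'"
  using levi_civita' by (simp add: levi_civita_connection_def)

lemma torsion_free': "X \<in> VF \<Longrightarrow> Y \<in> VF \<Longrightarrow> p \<in> U \<Longrightarrow> D' X Y p - D' Y X p = D X Y p - D Y X p"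
  using levi_civita' VF_U torsion_free UM by (simp add: levi_civita_connection_def)

lemma metric_compat':
  assumes X: "X \<in> VF" and Y: "Y \<in> VF" and Z: "Z \<in> VF" and p: "p \<in> U"
  shows "g p (D' X Y p) (Z p) + g p (Y p) (D' X Z p)
    = 2 * field_deriv A X f p * g p (Y p) (Z p) + g p (D X Y p) (Z p) + g p (Y p) (D X Z p)"
proof -
  have "exp (2 * f p) * (g p (D' X Y p) (Z p) + g p (Y p) (D' X Z p))
      = field_deriv A X (\<lambda>q. exp (2 * f q) * g q (Y q) (Z q)) p"
    using levi_civita' VF_U X Y Z p by (simp add: levi_civita_connection_def distrib_left)
  also have "\<dots> = exp (2 * f p) * (2 * field_deriv A X f p * g p (Y p) (Z p)
      + field_deriv A X (\<lambda>q. g q (Y q) (Z q)) p)"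
    using g_smooth[OF Y Z] openin_subset[OF U]
    by (intro field_deriv_exp_mult[OF U f _ p]) (rule smooth_function_subset)
  finally show ?thesis by (simp add: metric_compat[OF X Y Z UM[OF p]])
qed

lemma D'_in: "X \<in> vector_fields A U \<Longrightarrow> Y \<in> vector_fields A U \<Longrightarrow> D' X Y \<in> vector_fields A U"
  by (rule connection_closed[OF aff'])

text \<open>Koszul's argument for the difference of the two connections: it is symmetric because
  both are torsion-free, and its symmetrisation in the last two places is known from metric
  compatibility.\<close>

lemma g_D':
  assumes X: "X \<in> VF" and Y: "Y \<in> VF" and Z: "Z \<in> VF" and p: "p \<in> U"
  shows "g p (D' X Y p) (Z p) = g p (D X Y p) (Z p) + field_deriv A X f p * g p (Y p) (Z p)
    + field_deriv A Y f p * g p (X p) (Z p) - field_deriv A Z f p * g p (X p) (Y p)"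
proof -
  interpret paracontact_space "tangent_space A p" "\<phi> p" "\<eta> p" "\<xi> p" "g p"
    by (rule pointwise[OF UM[OF p]])
  have V [simp]: "W p \<in> tangent_space A p" if "W \<in> vector_fields A U" for W
    using vector_fieldsD(1)[OF that p] .
  note [simp] = VF_U D_in D'_in
  define c where "c P Q R = g p (D' P Q p) (R p) - g p (D P Q p) (R p)" for P Q R
  have c_diff: "c P Q R = g p (D' P Q p - D P Q p) (R p)" if "P \<in> VF" "Q \<in> VF" "R \<in> VF" for P Q R
    using that by (simp add: c_def homs)
  have c_sym: "c P Q R = c Q P R" if "P \<in> VF" "Q \<in> VF" "R \<in> VF" for P Q R
  proof -
    have "D' P Q p - D P Q p = D' Q P p - D Q P p"
      using torsion_free'[OF that(1,2) p] by (simp add: algebra_simps)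
    then show ?thesis using that by (simp add: c_diff)
  qed
  have c_compat: "c P Q R + c P R Q = 2 * field_deriv A P f p * g p (Q p) (R p)"
    if "P \<in> VF" "Q \<in> VF" "R \<in> VF" for P Q R
    using metric_compat'[OF that p] that g_sym[of "Q p" "D' P R p"] g_sym[of "Q p" "D P R p"]
    by (simp add: c_def)
  \<comment> \<open>The alternating sum of three compatibility identities; symmetry in the first two
    places removes all but \<open>c X Y Z\<close>.\<close>
  have "2 * c X Y Z = (c X Y Z + c X Z Y) + (c Y X Z + c Y Z X) - (c Z X Y + c Z Y X)"
    using c_sym X Y Z by simp
  also have "\<dots> = 2 * (field_deriv A X f p * g p (Y p) (Z p)
    + field_deriv A Y f p * g p (X p) (Z p) - field_deriv A Z f p * g p (X p) (Y p))"
    using X Y Z by (simp add: c_compat)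
  finally show ?thesis by (simp add: c_def)
qed

text \<open>The gradient of \<open>f\<close>, read off from \<open>D'\<^sub>\<xi> \<xi> - D\<^sub>\<xi> \<xi>\<close> (where \<open>D\<^sub>\<xi> \<xi> = 0\<close>): in this form its
  smoothness is immediate.\<close>

definition W :: "'m \<Rightarrow> ('m, 'e) tvec" where
  "W q = (2 * field_deriv A \<xi> f q) *\<^sub>R \<xi> q - D' \<xi> \<xi> q"

lemma W_in: "W \<in> vector_fields A U"
proof -
  have "smooth_function A U (\<lambda>q. 2 * field_deriv A \<xi> f q)"
    using smooth_function_cmult[OF U smooth_function_field_deriv[OF U f VF_U[OF xi_in]], of 2] .
  then show ?thesis
    unfolding W_def
    using vector_fields_diff[OF U vector_fields_scaleR[OF U _ VF_U[OF xi_in]] D'_in[OF VF_U[OF xi_in] VF_U[OF xi_in]]]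
    by blast
qed

text \<open>The case \<open>X = Y = \<xi>\<close> of \<open>g_D'\<close>, where
  \<open>D \<xi> \<xi> = 0\<close> and \<open>g \<xi> \<xi> = 1\<close>.\<close>

lemma g_W:
  assumes Z: "Z \<in> VF" and p: "p \<in> U"
  shows "g p (W p) (Z p) = field_deriv A Z f p"
proof -
  interpret paracontact_space "tangent_space A p" "\<phi> p" "\<eta> p" "\<xi> p" "g p"
    by (rule pointwise[OF UM[OF p]])
  have "D' \<xi> \<xi> p \<in> tangent_space A p" "Z p \<in> tangent_space A p"
    using vector_fieldsD(1)[OF D'_in[OF VF_U[OF xi_in] VF_U[OF xi_in]] p] VF_at[OF Z UM[OF p]] .
  then show ?thesis
    using g_D'[OF xi_in xi_in Z p] by (simp add: W_def homs g_xi D_xi[OF xi_in UM[OF p]])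
qed

text \<open>This is \<open>g_D'\<close> with the index raised, \<open>W\<close> representing the
  derivative of \<open>f\<close>. Nondegeneracy needs test vectors only, and each of them extends to
  a global field.\<close>

lemma D'_eq:
  assumes X: "X \<in> VF" and Y: "Y \<in> VF" and p: "p \<in> U"
  shows "D' X Y p = D X Y p + field_deriv A X f p *\<^sub>R Y p + field_deriv A Y f p *\<^sub>R X p
    - g p (X p) (Y p) *\<^sub>R W p"
proof -
  interpret paracontact_space "tangent_space A p" "\<phi> p" "\<eta> p" "\<xi> p" "g p"
    by (rule pointwise[OF UM[OF p]])
  let ?v = "D X Y p + field_deriv A X f p *\<^sub>R Y p + field_deriv A Y f p *\<^sub>R X p - g p (X p) (Y p) *\<^sub>R W p"
  have [simp]: "D' X Y p \<in> tangent_space A p" "D X Y p \<in> tangent_space A p" "X p \<in> tangent_space A p"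
    "Y p \<in> tangent_space A p" "W p \<in> tangent_space A p"
    using vector_fieldsD(1)[OF D'_in[OF VF_U[OF X] VF_U[OF Y]] p] VF_at[OF X UM[OF p]]
      VF_at[OF Y UM[OF p]] VF_at[OF D_in[OF X Y] UM[OF p]] vector_fieldsD(1)[OF W_in p] by simp_all
  have "D' X Y p - ?v = 0"
  proof (rule g_nondegenerate)
    fix w assume "w \<in> tangent_space A p"
    then obtain Z where Z: "Z \<in> VF" "Z p = w" using vector_field_extending UM[OF p] by metis
    have "Z p \<in> tangent_space A p" using VF_at[OF Z(1) UM[OF p]] .
    then have "g p (D' X Y p - ?v) (Z p) = 0"
      using g_D'[OF X Y Z(1) p] by (simp add: homs g_W[OF Z(1) p])
    then show "g p (D' X Y p - ?v) w = 0" using Z(2) by simp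
  qed (simp add: homs)
  then show ?thesis by simp
qed

text \<open>\<open>D'_eq\<close> differentiated along \<open>X\<close>. The derivative of
  \<open>W\<close> stays in terms of \<open>D'\<close>, since \<open>D'_eq\<close> concerns global
  fields and \<open>W\<close> is known as a field on \<open>U\<close>; it enters the coefficient
  \<open>Q\<close>.\<close>

lemma D'_D':
  assumes X: "X \<in> VF" and Y: "Y \<in> VF" and Z: "Z \<in> VF" and p: "p \<in> U"
  shows "D' X (D' Y Z) p = D' X (D Y Z) p
    + (field_deriv A X (field_deriv A Y f) p *\<^sub>R Z p + field_deriv A Y f p *\<^sub>R D' X Z p)
    + (field_deriv A X (field_deriv A Z f) p *\<^sub>R Y p + field_deriv A Z f p *\<^sub>R D' X Y p)
    - ((g p (D X Y p) (Z p) + g p (Y p) (D X Z p)) *\<^sub>R W p + g p (Y p) (Z p) *\<^sub>R D' X W p)"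
proof -
  note X' = VF_U[OF X] and Y' = VF_U[OF Y] and Z' = VF_U[OF Z]
  have s: "smooth_function A U (\<lambda>q. g q (Y q) (Z q))"
    by (rule smooth_function_subset[OF g_smooth[OF Y Z] openin_subset[OF U]])
  note h = smooth_function_field_deriv[OF U f Y'] smooth_function_field_deriv[OF U f Z'] s
  note I = VF_U[OF D_in[OF Y Z]] vector_fields_scaleR[OF U h(1) Z']
    vector_fields_scaleR[OF U h(2) Y'] vector_fields_scaleR[OF U h(3) W_in]
  note I2 = vector_fields_add[OF U I(1,2)] vector_fields_add[OF U vector_fields_add[OF U I(1,2)] I(3)]
  have "D' X (D' Y Z) p = D' X (\<lambda>q. D Y Z q + field_deriv A Y f q *\<^sub>R Z q + field_deriv A Z f q *\<^sub>R Y q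
      - g q (Y q) (Z q) *\<^sub>R W q) p"
    by (rule connection_cong[OF U aff' X' D'_in[OF Y' Z'] D'_eq[OF Y Z] p])
  also have "\<dots> = D' X (D Y Z) p + D' X (\<lambda>q. field_deriv A Y f q *\<^sub>R Z q) p
      + D' X (\<lambda>q. field_deriv A Z f q *\<^sub>R Y q) p - D' X (\<lambda>q. g q (Y q) (Z q) *\<^sub>R W q) p"
    by (simp add: connection_diff[OF U aff' X' I2(2) I(4) p] connection_add[OF aff' X' I2(1) I(3) p]
        connection_add[OF aff' X' I(1,2) p])
  finally show ?thesis
    by (simp add: connection_scaleR[OF aff' h(1) X' Z' p] connection_scaleR[OF aff' h(2) X' Y' p]
        connection_scaleR[OF aff' h(3) X' W_in p] metric_compat[OF X Y Z UM[OF p]])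
qed

text \<open>Substitute \<open>D'_eq\<close> into the vanishing curvature of \<open>D'\<close> and
  solve for that of \<open>D\<close>: the terms along \<open>Z p\<close> collect in
  \<open>s\<close>, those along \<open>X p\<close> and \<open>Y p\<close> in \<open>B\<close>, and
  those with \<open>W\<close> in \<open>Q\<close>.\<close>

lemma curvature_decomposition:
  assumes X: "X \<in> VF" and Y: "Y \<in> VF" and Z: "Z \<in> VF" and p: "p \<in> U"
    and flat: "curvature A D' X Y Z p = 0"
  defines "B \<equiv> \<lambda>Y Z. field_deriv A Y (field_deriv A Z f) p - field_deriv A (D Y Z) f p
      - field_deriv A Y f p * field_deriv A Z f p"
    and "s \<equiv> \<lambda>X Y. field_deriv A X (field_deriv A Y f) p - field_deriv A Y (field_deriv A X f) p
      - field_deriv A (lie_bracket A X Y) f p"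
    and "Q \<equiv> \<lambda>X. D' X W p - field_deriv A X f p *\<^sub>R W p"
  shows "curvature A D X Y Z p = - s X Y *\<^sub>R Z p + B Y Z *\<^sub>R X p - B X Z *\<^sub>R Y p
    + g p (Y p) (Z p) *\<^sub>R Q X - g p (X p) (Z p) *\<^sub>R Q Y"
proof -
  interpret paracontact_space "tangent_space A p" "\<phi> p" "\<eta> p" "\<xi> p" "g p"
    by (rule pointwise[OF UM[OF p]])
  note B = bracket_in[OF X Y] and L = torsion_free[OF X Y UM[OF p]]
  note V = VF_at[OF X UM[OF p]] VF_at[OF Y UM[OF p]] VF_at[OF Z UM[OF p]]
    VF_at[OF D_in[OF X Y] UM[OF p]] VF_at[OF D_in[OF Y X] UM[OF p]]
    VF_at[OF D_in[OF X Z] UM[OF p]] VF_at[OF D_in[OF Y Z] UM[OF p]]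
  have sym: "g p (Y p) (X p) = g p (X p) (Y p)" "g p (Y p) (D X Z p) = g p (D X Z p) (Y p)"
    "g p (X p) (D Y Z p) = g p (D Y Z p) (X p)"
    by (simp_all add: g_sym V)
  have "D' X (D' Y Z) p - D' Y (D' X Z) p - D' (lie_bracket A X Y) Z p = 0"
    using flat by (simp add: curvature_def)
  moreover have "D' (lie_bracket A X Y) Z p = D (lie_bracket A X Y) Z p
      + field_deriv A (lie_bracket A X Y) f p *\<^sub>R Z p
      + field_deriv A Z f p *\<^sub>R (D X Y p - D Y X p)
      - (g p (D X Y p) (Z p) - g p (D Y X p) (Z p)) *\<^sub>R W p"
    using D'_eq[OF B Z p] by (simp add: L g_hom_left V)
  ultimately show ?thesis
    unfolding B_def s_def Q_def curvature_def D'_D'[OF X Y Z p] D'_D'[OF Y X Z p]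
      D'_eq[OF X D_in[OF Y Z] p] D'_eq[OF Y D_in[OF X Z] p] D'_eq[OF X Y p] D'_eq[OF Y X p]
      D'_eq[OF X Z p] D'_eq[OF Y Z p]
    by (simp add: algebra_simps sym)
qed

lemma constant_curvature_at:
  assumes dim: "DIM('e) > 3" and p: "p \<in> U"
    and flat: "\<And>X Y Z. X \<in> VF \<Longrightarrow> Y \<in> VF \<Longrightarrow> Z \<in> VF \<Longrightarrow> curvature A D' X Y Z p = 0"
    and XYZ: "X \<in> VF" "Y \<in> VF" "Z \<in> VF"
  shows "curvature A D X Y Z p = g p (X p) (Z p) *\<^sub>R Y p - g p (Y p) (Z p) *\<^sub>R X p"
proof -
  interpret paracontact_space_large "tangent_space A p" "\<phi> p" "\<eta> p" "\<xi> p" "g p"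
    by (rule pointwise_large[OF UM[OF p] dim])
  show ?thesis
  \<comment> \<open>Evaluation of global fields at \<open>p\<close> serves as \<open>ev\<close>;
    unification with \<open>curvature_decomposition\<close> supplies \<open>s\<close>,
    \<open>B\<close> and \<open>Q\<close>.\<close>
  proof (rule curvature_rigidity[where F = VF and ev = "\<lambda>X. X p" and \<Phi> = "\<lambda>X q. \<phi> q (X q)" and \<Xi> = \<xi>
        and R = "\<lambda>X Y Z. curvature A D X Y Z p",
        OF _ _ _ _ _ _ _ _ _ curvature_decomposition[OF _ _ _ p flat] XYZ])
    show "\<exists>X\<in>VF. X p = v" if "v \<in> tangent_space A p" for v
      using vector_field_extending[OF UM[OF p] that] by blast
    show "D' X W p - field_deriv A X f p *\<^sub>R W p \<in> tangent_space A p" if "X \<in> VF" for X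
      using vector_fieldsD(1)[OF D'_in[OF VF_U[OF that] W_in] p] vector_fieldsD(1)[OF W_in p]
      by (simp add: homs)
  qed (simp_all add: VF_at UM p phi_in xi_in curvature_xi curvature_phi)
qed

end

theorem proposition5p2:
  fixes T :: "'m topology"
    and A :: "('m, 'e::euclidean_space) chart set"
    and \<phi> :: "'m \<Rightarrow> ('m, 'e) tvec \<Rightarrow> ('m, 'e) tvec"
    and \<eta> :: "'m \<Rightarrow> ('m, 'e) tvec \<Rightarrow> real"
    and \<xi> :: "'m \<Rightarrow> ('m, 'e) tvec"
    and g :: "'m \<Rightarrow> ('m, 'e) tvec \<Rightarrow> ('m, 'e) tvec \<Rightarrow> real"
    and D :: "('m, 'e) connection"
  assumes "quasi_para_Sasakian T A \<phi> \<eta> \<xi> g D"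
    and "DIM('e) > 3"
    and "conformally_flat T A g"
  shows "constant_curvature A (topspace T) g D (-1)"
proof -
  interpret quasi_para_Sasakian_mfd T A \<phi> \<eta> \<xi> g D
    using assms(1)
    by unfold_locales (auto simp: quasi_para_Sasakian_def almost_paracontact_metric_def)
  show ?thesis
    unfolding constant_curvature_def
  proof (intro ballI)
    fix X Y Z p assume XYZ: "X \<in> VF" "Y \<in> VF" "Z \<in> VF" and p: "p \<in> M"
    \<comment> \<open>The conformal factor exists only near \<open>p\<close>, which suffices since
      the claim is pointwise; global fields restrict to \<open>U\<close>, where flatness is
      available.\<close>
    obtain U f where hU: "openin T U" "p \<in> U" "smooth_function A U f"
      and "flat_metric A U (\<lambda>q v w. exp (2 * f q) * g q v w)"
      using assms(3) p unfolding conformally_flat_def by blast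
    then obtain D' where D': "levi_civita_connection A U (\<lambda>q v w. exp (2 * f q) * g q v w) D'"
      and flat: "\<And>X Y Z. X \<in> vector_fields A U \<Longrightarrow> Y \<in> vector_fields A U \<Longrightarrow>
        Z \<in> vector_fields A U \<Longrightarrow> curvature A D' X Y Z p = 0"
      unfolding flat_metric_def by blast
    interpret conformal_quasi_para_Sasakian T A \<phi> \<eta> \<xi> g D U f D'
      by unfold_locales (rule hU(1) hU(3) D')+
    have "curvature A D X Y Z p = g p (X p) (Z p) *\<^sub>R Y p - g p (Y p) (Z p) *\<^sub>R X p"
      by (rule constant_curvature_at[OF assms(2) hU(2) flat XYZ]) (rule VF_U, assumption)+
    then show "curvature A D X Y Z p
      = - 1 *\<^sub>R (g p (Y p) (Z p) *\<^sub>R X p - g p (X p) (Z p) *\<^sub>R Y p)"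
      by simp
  qed
qed

end
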